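(* Let $G_\mu$ be a group of $\mu$-good symmetries of the discrete mechanical system $(Q,L_d)$, for some $\mu\in\mathfrak g^*$. Let $q_\cdot=(q_0,\dots,q_N)$ be a discrete curve in $Q$ with momentum $\mu$ (i.e. $J_\mu(q_k,q_{k+1})=\mu$ for $0\le k\le N-1$) and let $\tau_k:=\pi_\mu(q_k)$ be the corresponding curve in $Q/G_\mu$. Then the following statements are equivalent: (1) $q_\cdot$ satisfies the variational principle $d\mathfrak S_d(q_\cdot)(\delta q_\cdot)=0$ for all infinitesimal variations $\delta q_\cdot$ over $q_\cdot$ with vanishing endpoints, where $\mathfrak S_d(q_\cdot):=\sum_{k=0}^{N-1}L_d(q_k,q_{k+1})$. (2) $q_\cdot$ satisfies the discrete Euler–Lagrange equations $D_2L_d(q_{k-1},q_k)+D_1L_d(q_k,q_{k+1})=0$ for $1\le k\le N-1$. (3) $\tau_\cdot$ satisfies $$d\breve{\mathfrak S}_\mu(\tau_\cdot)(\delta\tau_\cdot)=-\sum_{k=0}^{N-1}\breve f_\mu(\tau_k,\tau_{k+1})(\delta\tau_k,\delta\tau_{k+1})$$ for all infinitesimal variations $\delta\tau_\cdot$ over $\tau_\cdot$ with vanishing endpoints, where $\breve{\mathfrak S}_\mu(\tau_\cdot):=\sum_{k=0}^{N-1}\breve L_\mu(\tau_k,\tau_{k+1})$. (4) $\tau_\cdot$ satisfies the forced discrete Euler–Lagrange equations $$D_1\breve L_\mu(\tau_k,\tau_{k+1})+D_2\breve L_\mu(\tau_{k-1},\tau_k)+\breve f_\mu^+(\tau_{k-1},\tau_k)+\breve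 f_\mu^-(\tau_k,\tau_{k+1})=0,\qquad 1\le k\le N-1,$$ where $\breve f_\mu(\tau_k,\tau_{k+1})(\delta\tau_k,\delta\tau_{k+1})=\breve f_\mu^-(\tau_k,\tau_{k+1})(\delta\tau_k)+\breve f_\mu^+(\tau_k,\tau_{k+1})(\delta\tau_{k+1})$.
   Context: For a smooth $H$ on a product manifold, $D_iH$ denotes the partial tangent map in the $i$-th factor. $Q$ is a smooth manifold and $L_d:Q\times Q\to\mathbb R$ a smooth discrete Lagrangian that is regular: $\mathbb F^+L_d(q_0,q_1)=(q_1,D_2L_d(q_0,q_1))$ and $\mathbb F^-L_d(q_0,q_1)=(q_0,-D_1L_d(q_0,q_1))$ are local diffeomorphisms $Q\times Q\to T^*Q$. An infinitesimal variation over a discrete curve $q_\cdot$ is a choice of $\delta q_k\in T_{q_k}Q$, $k=0,\dots,N$; it has vanishing endpoints if $\delta q_0=0=\delta q_N$ (similarly for $\tau_\cdot$). A Lie group $G$ with Lie algebra $\mathfrak g$ acts on $Q$ freely and properly by a left action $l^Q$, and $L_d$ is invariant under the diagonal action. $\xi_Q$ is the infinitesimal generator of $\xi$. For $\mu\in\mathfrak g^*$, $G_\mu=\{g\in G:\mathrm{Ad}^*_{g^{-1}}\mu=\mu\}$ with Lie algebra $\mathfrak g_\mu$; $\pi_\mu:Q\to Q/G_\mu$ is the quotient principal bundle; $\mu$ also denotes its restriction to $\mathfrak g_\mu$. The momentum map $J_\mu:Q\times Q\to\mathfrak g_\mu^*$ is $J_\mu(q_0,q_1)\xi=-D_1L_d(q_0,q_1)\xi_Q(q_0)=D_2L_d(q_0,q_1)\xi_Q(q_1)$.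 $G_\mu$ is a group of $\mu$-good symmetries if $L_d$ is regular, for all $(q_0,q_1)$ the restriction of the bilinear form $D_2D_1L_d(q_0,q_1):T_{q_0}Q\times T_{q_1}Q\to\mathbb R$ to $T_{q_0}(G_\mu\cdot q_0)\times T_{q_1}(G_\mu\cdot q_1)$ is nondegenerate, and for each $q\in Q$ there is a unique $g\in G_\mu$ with $J_\mu(q,l^Q_g(q))=\mu$. Standing assumption: for all $(q_0,q_1)\in Q\times Q$ there is a unique $g\in G_\mu$ with $J_\mu(q_0,l^Q_{g^{-1}}(q_1))=\mu$, and the map $\mathcal A_\mu:Q\times Q\to G_\mu$, $\mathcal A_\mu(q_0,q_1):=g$, is smooth (the affine discrete connection associated to $J_\mu$). Then $\mathcal A_\mu(l^Q_{g_0}q_0,l^Q_{g_1}q_1)=g_1\mathcal A_\mu(q_0,q_1)g_0^{-1}$ and $\mathcal A_\mu(q_0,q_1)=e\iff J_\mu(q_0,q_1)=\mu$. For $q_0\in Q$, $\tau_1\in Q/G_\mu$, let $\overline{h^{q_0}_{d,\mu}}(\tau_1)$ be the unique $q_1\in Q$ with $\pi_\mu(q_1)=\tau_1$ and $J_\mu(q_0,q_1)=\mu$. A principal connection $\mathfrak A:TQ\to\mathfrak g_\mu$ on $\pi_\mu$ is fixed, with horizontal lift $h_\mu^q:T_{\pi_\mu(q)}(Q/G_\mu)\to T_qQ$. Reduced objects: $\check L_\mu:Q\times G_\mu\times(Q/G_\mu)\to\mathbb R$, $\check L_\mu(q_0,w,\tau_1):=L_d\big(q_0,l^Q_w(\overline{h^{q_0}_{d,\mu}}(\tau_1))\big)$;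 $\breve L_\mu(\tau_0,\tau_1):=\check L_\mu(q_0,e,\tau_1)$ for any $q_0\in\pi_\mu^{-1}(\tau_0)$; and the 1-form $\breve f_\mu$ on $(Q/G_\mu)\times(Q/G_\mu)$ given by $$\breve f_\mu(\tau_0,\tau_1)(\delta\tau_0,\delta\tau_1):=D_2\check L_\mu(q_0,e,\tau_1)\big(T_{(q_0,q_1)}\mathcal A_\mu(h_\mu^{q_0}(\delta\tau_0),h_\mu^{q_1}(\delta\tau_1))\big),$$ where $\pi_\mu(q_0)=\tau_0$ and $q_1=\overline{h^{q_0}_{d,\mu}}(\tau_1)$. *)

theory Defs
  imports "HOL-Analysis.Analysis" "HOL-Algebra.Group_Action"
begin

section \<open>Smooth manifolds\<close>

text \<open>
  A chart is a pair of a domain and a coordinate map into a normed space \<open>'e\<close>, whose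
  finite-dimensionality is part of \<open>smooth_manifold\<close> below (a type of class \<open>euclidean_space\<close>
  would exclude dimension 0).
  The field \<open>chart_at\<close> selects a chart around each point.  It serves to represent tangent vectors:
  \<open>T\<^sub>p M\<close> is the whole type \<open>'e\<close>, a tangent vector being given by its components with respect to
  \<open>chart_at M p\<close>.
\<close>

type_synonym ('a, 'e) chart = "'a set \<times> ('a \<Rightarrow> 'e)"

record ('a, 'e) manifold =
  atlas :: "('a, 'e) chart set"
  chart_at :: "'a \<Rightarrow> ('a, 'e) chart"

definition chart_inv :: "('a, 'e) chart \<Rightarrow> 'e \<Rightarrow> 'a" where
  "chart_inv c = inv_into (fst c) (snd c)"

definition points :: "('a, 'e) manifold \<Rightarrow> 'a set" where
  "points M = (\<Union>c\<in>atlas M. fst c)"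

definition mtop :: "('a, 'e::real_normed_vector) manifold \<Rightarrow> 'a topology" where
  "mtop M = topology (\<lambda>W. W \<subseteq> points M \<and> (\<forall>c\<in>atlas M. open (snd c ` (W \<inter> fst c))))"

text \<open>
  \<open>k\<close>-fold continuous differentiability on an open set.  On a finite-dimensional space the derivative
  is \<open>C\<^sup>k\<close> iff all its evaluations at fixed vectors are, so the recursion can stay within one
  function type.
\<close>

fun Ck_on :: "nat \<Rightarrow> 'e::real_normed_vector set \<Rightarrow> ('e \<Rightarrow> 'f::real_normed_vector) \<Rightarrow> bool" where
  "Ck_on 0 S f \<longleftrightarrow> continuous_on S f"
| "Ck_on (Suc k) S f \<longleftrightarrow>
     (\<forall>x\<in>S. f differentiable (at x)) \<and> (\<forall>v. Ck_on k S (\<lambda>x. frechet_derivative f (at x) v))"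

definition smooth_on :: "'e::real_normed_vector set \<Rightarrow> ('e \<Rightarrow> 'f::real_normed_vector) \<Rightarrow> bool" where
  "smooth_on S f \<longleftrightarrow> (\<forall>k. Ck_on k S f)"

definition smooth_manifold :: "('a, 'e::real_normed_vector) manifold \<Rightarrow> bool" where
  "smooth_manifold M \<longleftrightarrow>
     (\<exists>B::'e set. finite B \<and> span B = UNIV) \<and>
     (\<forall>c\<in>atlas M. inj_on (snd c) (fst c)) \<and>
     (\<forall>c\<in>atlas M. \<forall>d\<in>atlas M.
        open (snd c ` (fst c \<inter> fst d)) \<and>
        smooth_on (snd c ` (fst c \<inter> fst d)) (snd d \<circ> chart_inv c)) \<and>
     (\<forall>p\<in>points M. chart_at M p \<in> atlas M \<and> p \<in> fst (chart_at M p)) \<and>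
     Hausdorff_space (mtop M) \<and> second_countable (mtop M)"

lemma openin_mtop:
  fixes M :: "('a, 'e::real_normed_vector) manifold"
  assumes "\<And>c. c \<in> atlas M \<Longrightarrow> inj_on (snd c) (fst c)"
  shows "openin (mtop M) W \<longleftrightarrow> W \<subseteq> points M \<and> (\<forall>c\<in>atlas M. open (snd c ` (W \<inter> fst c)))"
proof -
  have inter: "snd c ` (S \<inter> T \<inter> fst c) = snd c ` (S \<inter> fst c) \<inter> snd c ` (T \<inter> fst c)"
    if "c \<in> atlas M" for c S T
    using inj_on_image_Int[OF assms[OF that], of "S \<inter> fst c" "T \<inter> fst c"]
    by (simp add: Int_assoc Int_left_commute Int_commute)
  have union: "snd c ` (\<Union>\<K> \<inter> fst c) = (\<Union>K\<in>\<K>. snd c ` (K \<inter> fst c))" for c :: "('a, 'e) chart" and \<K>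
    by blast
  have "istopology (\<lambda>W. W \<subseteq> points M \<and> (\<forall>c\<in>atlas M. open (snd c ` (W \<inter> fst c))))"
    unfolding istopology_def by (auto simp: inter union)
  then show ?thesis
    unfolding mtop_def by (simp add: topology_inverse')
qed

definition smooth_map_on ::
  "('a, 'e::real_normed_vector) manifold \<Rightarrow> ('b, 'f::real_normed_vector) manifold \<Rightarrow> 'a set \<Rightarrow> ('a \<Rightarrow> 'b) \<Rightarrow> bool"
where
  "smooth_map_on M N W f \<longleftrightarrow>
     openin (mtop M) W \<and>
     continuous_map (subtopology (mtop M) W) (mtop N) f \<and>
     (\<forall>c\<in>atlas M. \<forall>d\<in>atlas N.
        smooth_on (snd c ` {p \<in> W \<inter> fst c. f p \<in> fst d}) (snd d \<circ> f \<circ> chart_inv c))"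

definition smooth_map ::
  "('a, 'e::real_normed_vector) manifold \<Rightarrow> ('b, 'f::real_normed_vector) manifold \<Rightarrow> ('a \<Rightarrow> 'b) \<Rightarrow> bool"
where
  "smooth_map M N f \<longleftrightarrow> smooth_map_on M N (points M) f"

definition diffeo_on ::
  "('a, 'e::real_normed_vector) manifold \<Rightarrow> ('b, 'f::real_normed_vector) manifold \<Rightarrow>
   'a set \<Rightarrow> 'b set \<Rightarrow> ('a \<Rightarrow> 'b) \<Rightarrow> bool"
where
  "diffeo_on M N V W f \<longleftrightarrow>
     bij_betw f V W \<and> smooth_map_on M N V f \<and> smooth_map_on N M W (inv_into V f)"

definition local_diffeo ::
  "('a, 'e::real_normed_vector) manifold \<Rightarrow> ('b, 'f::real_normed_vector) manifold \<Rightarrow> ('a \<Rightarrow> 'b) \<Rightarrow> bool"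
where
  "local_diffeo M N f \<longleftrightarrow> (\<forall>p\<in>points M. \<exists>V W. p \<in> V \<and> diffeo_on M N V W f)"

definition vs_manifold :: "('e::real_normed_vector, 'e) manifold" where
  "vs_manifold = \<lparr>atlas = {(UNIV, \<lambda>x. x)}, chart_at = (\<lambda>_. (UNIV, \<lambda>x. x))\<rparr>"

text \<open>The choice of \<open>chart_at\<close> on a product makes \<open>T\<^bsub>(p,q)\<^esub>(M \<times> N) = T\<^sub>p M \<times> T\<^sub>q N\<close> hold literally.\<close>

definition prod_chart :: "('a, 'e) chart \<Rightarrow> ('b, 'f) chart \<Rightarrow> ('a \<times> 'b, 'e \<times> 'f) chart" where
  "prod_chart c d = (fst c \<times> fst d, map_prod (snd c) (snd d))"

definition prod_manifold ::
  "('a, 'e) manifold \<Rightarrow> ('b, 'f) manifold \<Rightarrow> ('a \<times> 'b, 'e \<times> 'f) manifold"  (infixr "\<times>\<^sub>M" 75)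
where
  "M \<times>\<^sub>M N = \<lparr>atlas = {prod_chart c d | c d. c \<in> atlas M \<and> d \<in> atlas N},
             chart_at = (\<lambda>(p, q). prod_chart (chart_at M p) (chart_at N q))\<rparr>"

definition tangent_map ::
  "('a, 'e::real_normed_vector) manifold \<Rightarrow> ('b, 'f::real_normed_vector) manifold \<Rightarrow>
   ('a \<Rightarrow> 'b) \<Rightarrow> 'a \<Rightarrow> 'e \<Rightarrow> 'f"
where
  "tangent_map M N f p =
     frechet_derivative (snd (chart_at N (f p)) \<circ> f \<circ> chart_inv (chart_at M p))
       (at (snd (chart_at M p) p))"

abbreviation differential ::
  "('a, 'e::real_normed_vector) manifold \<Rightarrow> ('a \<Rightarrow> real) \<Rightarrow> 'a \<Rightarrow> 'e \<Rightarrow> real"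
where
  "differential M f \<equiv> tangent_map M vs_manifold f"

text \<open>
  A point of \<open>TM\<close> is a pair \<open>(p, v)\<close> with \<open>v\<close> in \<open>T\<^sub>p M\<close>; a chart \<open>\<phi>\<close> of \<open>M\<close> induces the chart
  \<open>(p, v) \<mapsto> (\<phi> p, T\<^sub>p\<phi> v)\<close> of \<open>TM\<close> and the chart \<open>(p, \<alpha>) \<mapsto> (\<phi> p, \<alpha> \<circ> (T\<^sub>p\<phi>)\<^sup>-\<^sup>1)\<close> of the cotangent bundle.
\<close>

definition tangent_chart ::
  "('a, 'e::real_normed_vector) manifold \<Rightarrow> ('a, 'e) chart \<Rightarrow> ('a \<times> 'e, 'e \<times> 'e) chart"
where
  "tangent_chart M c =
     (fst c \<times> UNIV, \<lambda>(p, v). (snd c p, tangent_map M vs_manifold (snd c) p v))"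

definition tangent_bundle ::
  "('a, 'e::real_normed_vector) manifold \<Rightarrow> ('a \<times> 'e, 'e \<times> 'e) manifold"
where
  "tangent_bundle M = \<lparr>atlas = tangent_chart M ` atlas M,
                       chart_at = (\<lambda>(p, v). tangent_chart M (chart_at M p))\<rparr>"

definition cotangent_chart ::
  "('a, 'e::real_normed_vector) manifold \<Rightarrow> ('a, 'e) chart \<Rightarrow>
   ('a \<times> ('e \<Rightarrow>\<^sub>L real), 'e \<times> ('e \<Rightarrow>\<^sub>L real)) chart"
where
  "cotangent_chart M c =
     (fst c \<times> UNIV,
      \<lambda>(p, \<alpha>). (snd c p, \<alpha> o\<^sub>L Blinfun (tangent_map vs_manifold M (chart_inv c) (snd c p))))"

definition cotangent_bundle ::
  "('a, 'e::real_normed_vector) manifold \<Rightarrow> ('a \<times> ('e \<Rightarrow>\<^sub>L real), 'e \<times> ('e \<Rightarrow>\<^sub>L real)) manifold"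
where
  "cotangent_bundle M = \<lparr>atlas = cotangent_chart M ` atlas M,
                         chart_at = (\<lambda>(p, \<alpha>). cotangent_chart M (chart_at M p))\<rparr>"

definition embedded_submanifold ::
  "('a, 'e::real_normed_vector) manifold \<Rightarrow> ('a, 'f::real_normed_vector) manifold \<Rightarrow> bool"
where
  "embedded_submanifold S M \<longleftrightarrow>
     smooth_manifold S \<and> points S \<subseteq> points M \<and>
     mtop S = subtopology (mtop M) (points S) \<and>
     smooth_map S M (\<lambda>p. p) \<and>
     (\<forall>p\<in>points S. inj (tangent_map S M (\<lambda>p. p) p))"


section \<open>Lie groups, actions and principal bundles\<close>

definition lie_group :: "'g monoid \<Rightarrow> ('g, 'l::real_normed_vector) manifold \<Rightarrow> bool" where
  "lie_group G MG \<longleftrightarrow>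
     group G \<and> smooth_manifold MG \<and> carrier G = points MG \<and>
     smooth_map (MG \<times>\<^sub>M MG) MG (\<lambda>(g, h). g \<otimes>\<^bsub>G\<^esub> h) \<and>
     smooth_map MG MG (\<lambda>g. inv\<^bsub>G\<^esub> g)"

text \<open>The Lie algebra of \<open>G\<close> is the tangent space at \<open>\<one>\<^bsub>G\<^esub>\<close>, i.e. the type \<open>'l\<close>.\<close>

definition Ad :: "'g monoid \<Rightarrow> ('g, 'l::real_normed_vector) manifold \<Rightarrow> 'g \<Rightarrow> 'l \<Rightarrow> 'l" where
  "Ad G MG g = tangent_map MG MG (\<lambda>h. g \<otimes>\<^bsub>G\<^esub> h \<otimes>\<^bsub>G\<^esub> inv\<^bsub>G\<^esub> g) \<one>\<^bsub>G\<^esub>"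

definition coAd ::
  "'g monoid \<Rightarrow> ('g, 'l::real_normed_vector) manifold \<Rightarrow> 'g \<Rightarrow> ('l \<Rightarrow> real) \<Rightarrow> 'l \<Rightarrow> real"
where
  "coAd G MG g \<mu> = (\<lambda>\<xi>. \<mu> (Ad G MG g \<xi>))"

definition isotropy_group ::
  "'g monoid \<Rightarrow> ('g, 'l::real_normed_vector) manifold \<Rightarrow> ('l \<Rightarrow> real) \<Rightarrow> 'g monoid"
where
  "isotropy_group G MG \<mu> = G\<lparr>carrier := {g \<in> carrier G. coAd G MG (inv\<^bsub>G\<^esub> g) \<mu> = \<mu>}\<rparr>"

text \<open>The restriction of \<open>\<mu>\<close> to the Lie algebra \<open>T\<^bsub>\<one>\<^esub>H\<close> of a Lie subgroup \<open>H\<close> of \<open>G\<close>, along the tangent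
  map of the inclusion.\<close>

definition restrict_dual ::
  "'g monoid \<Rightarrow> ('g, 'l::real_normed_vector) manifold \<Rightarrow> ('g, 'h::real_normed_vector) manifold \<Rightarrow>
   ('l \<Rightarrow> real) \<Rightarrow> 'h \<Rightarrow> real"
where
  "restrict_dual G MG MH \<mu> = (\<lambda>\<xi>. \<mu> (tangent_map MH MG (\<lambda>g. g) \<one>\<^bsub>G\<^esub> \<xi>))"

definition smooth_action ::
  "'g monoid \<Rightarrow> ('g, 'l::real_normed_vector) manifold \<Rightarrow> ('q, 'e::real_normed_vector) manifold \<Rightarrow>
   ('g \<Rightarrow> 'q \<Rightarrow> 'q) \<Rightarrow> bool"
where
  "smooth_action G MG Q l \<longleftrightarrow>
     group_action G (points Q) l \<and> smooth_map (MG \<times>\<^sub>M Q) Q (\<lambda>(g, q). l g q)"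

definition free_action ::
  "'g monoid \<Rightarrow> ('q, 'e::real_normed_vector) manifold \<Rightarrow> ('g \<Rightarrow> 'q \<Rightarrow> 'q) \<Rightarrow> bool"
where
  "free_action G Q l \<longleftrightarrow> (\<forall>g\<in>carrier G. \<forall>q\<in>points Q. l g q = q \<longrightarrow> g = \<one>\<^bsub>G\<^esub>)"

definition proper_action ::
  "('g, 'l::real_normed_vector) manifold \<Rightarrow> ('q, 'e::real_normed_vector) manifold \<Rightarrow>
   ('g \<Rightarrow> 'q \<Rightarrow> 'q) \<Rightarrow> bool"
where
  "proper_action MG Q l \<longleftrightarrow>
     proper_map (prod_topology (mtop MG) (mtop Q)) (prod_topology (mtop Q) (mtop Q))
       (\<lambda>(g, q). (l g q, q))"

text \<open>The infinitesimal generator \<open>\<xi>\<^sub>Q(q)\<close>, as the derivative of the orbit map at the identity.\<close>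

definition inf_gen ::
  "'g monoid \<Rightarrow> ('g, 'l::real_normed_vector) manifold \<Rightarrow> ('q, 'e::real_normed_vector) manifold \<Rightarrow>
   ('g \<Rightarrow> 'q \<Rightarrow> 'q) \<Rightarrow> 'l \<Rightarrow> 'q \<Rightarrow> 'e"
where
  "inf_gen G MG Q l \<xi> q = tangent_map MG Q (\<lambda>g. l g q) \<one>\<^bsub>G\<^esub> \<xi>"

definition orbit_tangent_space ::
  "'g monoid \<Rightarrow> ('g, 'l::real_normed_vector) manifold \<Rightarrow> ('q, 'e::real_normed_vector) manifold \<Rightarrow>
   ('g \<Rightarrow> 'q \<Rightarrow> 'q) \<Rightarrow> 'q \<Rightarrow> 'e set"
where
  "orbit_tangent_space G MG Q l q = range (\<lambda>\<xi>. inf_gen G MG Q l \<xi> q)"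

text \<open>
  \<open>B\<close> is the orbit space with a smooth structure making \<open>q \<mapsto> G \<cdot> q\<close> a (left) principal bundle.  This
  determines the smooth structure of \<open>B\<close>.
\<close>

definition quotient_principal_bundle ::
  "'g monoid \<Rightarrow> ('g, 'l::real_normed_vector) manifold \<Rightarrow> ('q, 'e::real_normed_vector) manifold \<Rightarrow>
   ('g \<Rightarrow> 'q \<Rightarrow> 'q) \<Rightarrow> ('q set, 'b::real_normed_vector) manifold \<Rightarrow> bool"
where
  "quotient_principal_bundle G MG Q l B \<longleftrightarrow>
     smooth_manifold B \<and> points B = orbits G (points Q) l \<and> smooth_map Q B (orbit G l) \<and>
     (\<forall>b\<in>points B. \<exists>U \<Phi>. b \<in> U \<and> openin (mtop B) U \<and>
        diffeo_on (B \<times>\<^sub>M MG) Q (U \<times> carrier G) {q \<in> points Q. orbit G l q \<in> U} \<Phi> \<and>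
        (\<forall>u\<in>U. \<forall>g\<in>carrier G. orbit G l (\<Phi> (u, g)) = u) \<and>
        (\<forall>u\<in>U. \<forall>g\<in>carrier G. \<forall>h\<in>carrier G. \<Phi> (u, g \<otimes>\<^bsub>G\<^esub> h) = l g (\<Phi> (u, h))))"

definition principal_connection ::
  "'g monoid \<Rightarrow> ('g, 'l::real_normed_vector) manifold \<Rightarrow> ('q, 'e::real_normed_vector) manifold \<Rightarrow>
   ('g \<Rightarrow> 'q \<Rightarrow> 'q) \<Rightarrow> ('q \<Rightarrow> 'e \<Rightarrow> 'l) \<Rightarrow> bool"
where
  "principal_connection G MG Q l \<AA> \<longleftrightarrow>
     smooth_map (tangent_bundle Q) vs_manifold (\<lambda>(q, v). \<AA> q v) \<and>
     (\<forall>q\<in>points Q. linear (\<AA> q)) \<and>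
     (\<forall>q\<in>points Q. \<forall>\<xi>. \<AA> q (inf_gen G MG Q l \<xi> q) = \<xi>) \<and>
     (\<forall>g\<in>carrier G. \<forall>q\<in>points Q. \<forall>v.
        \<AA> (l g q) (tangent_map Q Q (l g) q v) = Ad G MG g (\<AA> q v))"

definition horizontal_lift ::
  "('q, 'e::real_normed_vector) manifold \<Rightarrow> ('t, 'b::real_normed_vector) manifold \<Rightarrow> ('q \<Rightarrow> 't) \<Rightarrow>
   ('q \<Rightarrow> 'e \<Rightarrow> 'l::real_normed_vector) \<Rightarrow> 'q \<Rightarrow> 'b \<Rightarrow> 'e"
where
  "horizontal_lift Q B \<pi> \<AA> q w = (THE v. \<AA> q v = 0 \<and> tangent_map Q B \<pi> q v = w)"


section \<open>Discrete mechanics\<close>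

definition D1 ::
  "('a, 'e::real_normed_vector) manifold \<Rightarrow> ('a \<times> 'b \<Rightarrow> real) \<Rightarrow> 'a \<times> 'b \<Rightarrow> 'e \<Rightarrow> real"
where
  "D1 M H = (\<lambda>(x, y). differential M (\<lambda>x'. H (x', y)) x)"

definition D2 ::
  "('b, 'f::real_normed_vector) manifold \<Rightarrow> ('a \<times> 'b \<Rightarrow> real) \<Rightarrow> 'a \<times> 'b \<Rightarrow> 'f \<Rightarrow> real"
where
  "D2 N H = (\<lambda>(x, y). differential N (\<lambda>y'. H (x, y')) y)"

definition D2D1 ::
  "('q, 'e::real_normed_vector) manifold \<Rightarrow> ('q \<times> 'q \<Rightarrow> real) \<Rightarrow> 'q \<times> 'q \<Rightarrow> 'e \<Rightarrow> 'e \<Rightarrow> real"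
where
  "D2D1 Q L qq u v = D2 Q (\<lambda>qq'. D1 Q L qq' u) qq v"

definition regular_lagrangian ::
  "('q, 'e::real_normed_vector) manifold \<Rightarrow> ('q \<times> 'q \<Rightarrow> real) \<Rightarrow> bool"
where
  "regular_lagrangian Q L \<longleftrightarrow>
     local_diffeo (Q \<times>\<^sub>M Q) (cotangent_bundle Q) (\<lambda>(q0, q1). (q1, Blinfun (D2 Q L (q0, q1)))) \<and>
     local_diffeo (Q \<times>\<^sub>M Q) (cotangent_bundle Q) (\<lambda>(q0, q1). (q0, - Blinfun (D1 Q L (q0, q1))))"

definition nondegenerate_on :: "'e::zero set \<Rightarrow> 'f::zero set \<Rightarrow> ('e \<Rightarrow> 'f \<Rightarrow> real) \<Rightarrow> bool" where
  "nondegenerate_on V W b \<longleftrightarrow>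
     (\<forall>v\<in>V. (\<forall>w\<in>W. b v w = 0) \<longrightarrow> v = 0) \<and> (\<forall>w\<in>W. (\<forall>v\<in>V. b v w = 0) \<longrightarrow> w = 0)"

text \<open>Below, \<open>H\<close> with manifold structure \<open>MH\<close> plays the role of \<open>G\<^sub>\<mu>\<close>, and \<open>\<mu>\<close> is a functional on
  its Lie algebra.\<close>

definition momentum_map ::
  "'g monoid \<Rightarrow> ('g, 'h::real_normed_vector) manifold \<Rightarrow> ('q, 'e::real_normed_vector) manifold \<Rightarrow>
   ('g \<Rightarrow> 'q \<Rightarrow> 'q) \<Rightarrow> ('q \<times> 'q \<Rightarrow> real) \<Rightarrow> 'q \<times> 'q \<Rightarrow> 'h \<Rightarrow> real"
where
  "momentum_map H MH Q l L = (\<lambda>(q0, q1) \<xi>. - D1 Q L (q0, q1) (inf_gen H MH Q l \<xi> q0))"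

definition good_symmetries ::
  "'g monoid \<Rightarrow> ('g, 'h::real_normed_vector) manifold \<Rightarrow> ('q, 'e::real_normed_vector) manifold \<Rightarrow>
   ('g \<Rightarrow> 'q \<Rightarrow> 'q) \<Rightarrow> ('q \<times> 'q \<Rightarrow> real) \<Rightarrow> ('h \<Rightarrow> real) \<Rightarrow> bool"
where
  "good_symmetries H MH Q l L \<mu> \<longleftrightarrow>
     regular_lagrangian Q L \<and>
     (\<forall>q0\<in>points Q. \<forall>q1\<in>points Q.
        nondegenerate_on (orbit_tangent_space H MH Q l q0) (orbit_tangent_space H MH Q l q1)
          (D2D1 Q L (q0, q1))) \<and>
     (\<forall>q\<in>points Q. \<exists>!g. g \<in> carrier H \<and> momentum_map H MH Q l L (q, l g q) = \<mu>)"

definition affine_connection ::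
  "'g monoid \<Rightarrow> ('g \<Rightarrow> 'q \<Rightarrow> 'q) \<Rightarrow> ('q \<times> 'q \<Rightarrow> 'h \<Rightarrow> real) \<Rightarrow> ('h \<Rightarrow> real) \<Rightarrow> 'q \<times> 'q \<Rightarrow> 'g"
where
  "affine_connection H l J \<mu> =
     (\<lambda>(q0, q1). THE g. g \<in> carrier H \<and> J (q0, l (inv\<^bsub>H\<^esub> g) q1) = \<mu>)"

definition discrete_lift ::
  "('q, 'e) manifold \<Rightarrow> ('q \<Rightarrow> 't) \<Rightarrow> ('q \<times> 'q \<Rightarrow> 'h \<Rightarrow> real) \<Rightarrow> ('h \<Rightarrow> real) \<Rightarrow> 'q \<Rightarrow> 't \<Rightarrow> 'q"
where
  "discrete_lift Q \<pi> J \<mu> q0 \<tau>1 = (THE q1. q1 \<in> points Q \<and> \<pi> q1 = \<tau>1 \<and> J (q0, q1) = \<mu>)"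

definition check_lagrangian ::
  "('g \<Rightarrow> 'q \<Rightarrow> 'q) \<Rightarrow> ('q \<Rightarrow> 't \<Rightarrow> 'q) \<Rightarrow> ('q \<times> 'q \<Rightarrow> real) \<Rightarrow> 'q \<times> 'g \<times> 't \<Rightarrow> real"
where
  "check_lagrangian l hdisc L = (\<lambda>(q0, w, \<tau>1). L (q0, l w (hdisc q0 \<tau>1)))"

definition fibre_point :: "('q, 'e) manifold \<Rightarrow> ('q \<Rightarrow> 't) \<Rightarrow> 't \<Rightarrow> 'q" where
  "fibre_point Q \<pi> \<tau> = (SOME q. q \<in> points Q \<and> \<pi> q = \<tau>)"

definition reduced_lagrangian ::
  "'g monoid \<Rightarrow> ('q, 'e) manifold \<Rightarrow> ('q \<Rightarrow> 't) \<Rightarrow> ('q \<times> 'g \<times> 't \<Rightarrow> real) \<Rightarrow> 't \<times> 't \<Rightarrow> real"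
where
  "reduced_lagrangian H Q \<pi> Lc = (\<lambda>(\<tau>0, \<tau>1). Lc (fibre_point Q \<pi> \<tau>0, \<one>\<^bsub>H\<^esub>, \<tau>1))"

definition reduced_force ::
  "'g monoid \<Rightarrow> ('g, 'h::real_normed_vector) manifold \<Rightarrow> ('q, 'e::real_normed_vector) manifold \<Rightarrow>
   ('q \<Rightarrow> 't) \<Rightarrow> ('q \<Rightarrow> 't \<Rightarrow> 'q) \<Rightarrow> ('q \<Rightarrow> 'b \<Rightarrow> 'e) \<Rightarrow> ('q \<times> 'q \<Rightarrow> 'g) \<Rightarrow>
   ('q \<times> 'g \<times> 't \<Rightarrow> real) \<Rightarrow> 't \<times> 't \<Rightarrow> 'b \<times> 'b \<Rightarrow> real"
where
  "reduced_force H MH Q \<pi> hdisc hlift A Lc = (\<lambda>(\<tau>0, \<tau>1) (d\<tau>0, d\<tau>1).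
     let q0 = fibre_point Q \<pi> \<tau>0; q1 = hdisc q0 \<tau>1
     in differential MH (\<lambda>w. Lc (q0, w, \<tau>1)) \<one>\<^bsub>H\<^esub>
          (tangent_map (Q \<times>\<^sub>M Q) MH A (q0, q1) (hlift q0 d\<tau>0, hlift q1 d\<tau>1)))"

definition action_sum :: "('q \<times> 'q \<Rightarrow> real) \<Rightarrow> nat \<Rightarrow> (nat \<Rightarrow> 'q) \<Rightarrow> real" where
  "action_sum L N q = (\<Sum>k<N. L (q k, q (Suc k)))"

text \<open>
  The differential of a smooth function \<open>S\<close> of discrete curves, applied to an infinitesimal variation
  \<open>dq\<close>: the derivative of \<open>S\<close> at \<open>t = 0\<close> along the deformation \<open>t \<mapsto> (q\<^sub>k(t))\<^sub>k\<close> of \<open>q\<close> with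
  \<open>q\<^sub>k(0) = q\<^sub>k\<close> and velocity \<open>dq\<^sub>k\<close> that is affine in the charts \<open>chart_at M (q k)\<close>.
  By the chain rule, any other smooth deformation of \<open>q\<close> with these velocities gives the same value.
  \<open>S\<close> is meant to depend only on finitely many \<open>q k\<close>, as \<open>action_sum L N\<close> does.
\<close>

definition curve_deformation ::
  "('q, 'e::real_normed_vector) manifold \<Rightarrow> (nat \<Rightarrow> 'q) \<Rightarrow> (nat \<Rightarrow> 'e) \<Rightarrow> real \<Rightarrow> nat \<Rightarrow> 'q"
where
  "curve_deformation M q dq t k =
     chart_inv (chart_at M (q k)) (snd (chart_at M (q k)) (q k) + t *\<^sub>R dq k)"

definition curve_differential ::
  "('q, 'e::real_normed_vector) manifold \<Rightarrow> ((nat \<Rightarrow> 'q) \<Rightarrow> real) \<Rightarrow> (nat \<Rightarrow> 'q) \<Rightarrow> (nat \<Rightarrow> 'e) \<Rightarrow> real"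
where
  "curve_differential M S q dq = deriv (\<lambda>t. S (curve_deformation M q dq t)) 0"

end

theory Submission
  imports Defs
begin

text \<open>
  The proof compares the differentials of the Lagrangian \<open>L\<close> and of the reduced Lagrangian on the
  level set \<open>J = \<nu>\<close> of the momentum map.  Write \<open>A(q\<^sub>0, q\<^sub>1)\<close> for the affine discrete connection.  The
  point \<open>A(q\<^sub>0, q\<^sub>1)\<^sup>-\<^sup>1 q\<^sub>1\<close> is the only point of the orbit of \<open>q\<^sub>1\<close> that has momentum \<open>\<nu>\<close> with \<open>q\<^sub>0\<close>, so
  the reduced Lagrangian pulls back to \<open>L(q\<^sub>0, A(q\<^sub>0, q\<^sub>1)\<^sup>-\<^sup>1 q\<^sub>1)\<close> (lemma \<open>Lr_eq\<close>).  Now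
  \<open>L(q\<^sub>0, q\<^sub>1) = L(q\<^sub>0, w A(q\<^sub>0, q\<^sub>1)\<^sup>-\<^sup>1 q\<^sub>1)\<close> with \<open>w = A(q\<^sub>0, q\<^sub>1)\<close>, and \<open>w = \<one>\<close> on the level set.  Differentiating
  there with respect to \<open>(q\<^sub>0, q\<^sub>1)\<close> and \<open>w\<close> separately shows that \<open>dL\<close> is the pullback of the differential
  of the reduced Lagrangian plus the term that defines the reduced force
  (lemma \<open>tangent_L_reduced\<close>).  On horizontal lifts this says that \<open>dL\<close> is the differential of
  the reduced Lagrangian plus the force (lemma \<open>force_eq\<close>).  The force is computed at a chosen
  point of each fibre; \<open>G\<^sub>\<mu>\<close>-equivariance of \<open>J\<close>, of the horizontal lift and of \<open>dL\<close> moves that point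
  to the given one.

  Every tangent vector of \<open>Q\<close> is the sum of a vertical vector \<open>\<xi>\<^sub>Q(q)\<close> and a horizontal one.  On a curve of
  constant momentum the discrete Euler--Lagrange equation holds automatically in vertical directions:
  there it reads \<open>J(q\<^sub>k\<^sub>-\<^sub>1, q\<^sub>k) \<xi> = J(q\<^sub>k, q\<^sub>k\<^sub>+\<^sub>1) \<xi>\<close>.  So the Euler--Lagrange equations are equivalent to their
  horizontal parts (lemma \<open>euler_lagrange_iff_horizontal\<close>), and these are the forced equations
  on the quotient.  Both variational principles are related to their equations by the same summation
  by parts (lemma \<open>discrete_fundamental_lemma\<close>).

  All of this uses only first derivatives at single points, so the differential calculus is developed
  for maps between manifolds that are differentiable at one point.
\<close>

section \<open>Tangent maps at a point\<close>

text \<open>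
  The part of the manifold axioms on which the calculus at a point depends.  Unlike the full axioms,
  it passes to products with little effort.
\<close>

definition charted :: "('a, 'e::real_normed_vector) manifold \<Rightarrow> bool" where
  "charted M \<longleftrightarrow>
     (\<forall>c\<in>atlas M. inj_on (snd c) (fst c)) \<and>
     (\<forall>c\<in>atlas M. \<forall>d\<in>atlas M. open (snd c ` (fst c \<inter> fst d))) \<and>
     (\<forall>p\<in>points M. chart_at M p \<in> atlas M \<and> p \<in> fst (chart_at M p))"

text \<open>
  The neighbourhood filter, transported from the preferred chart.  It is defined without
  the manifold topology, so that local statements can be proved in coordinates.
\<close>

definition nbhds :: "('a, 'e::real_normed_vector) manifold \<Rightarrow> 'a \<Rightarrow> 'a filter" where
  "nbhds M p = filtermap (chart_inv (chart_at M p)) (nhds (snd (chart_at M p) p))"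

text \<open>
  The clause on neighbourhoods keeps \<open>f\<close> in the preferred chart of \<open>f p\<close> near \<open>p\<close>.  Without it
  the coordinate expression would depend on the arbitrary values of charts outside their domains, and
  the chain rule would fail.
\<close>

definition has_tangent ::
  "('a, 'e::real_normed_vector) manifold \<Rightarrow> ('b, 'f::real_normed_vector) manifold \<Rightarrow>
   ('a \<Rightarrow> 'b) \<Rightarrow> 'a \<Rightarrow> ('e \<Rightarrow> 'f) \<Rightarrow> bool"
where
  "has_tangent M N f p D \<longleftrightarrow>
     p \<in> points M \<and> f p \<in> points N \<and> (\<forall>\<^sub>F x in nbhds M p. f x \<in> fst (chart_at N (f p))) \<and>
     (snd (chart_at N (f p)) \<circ> f \<circ> chart_inv (chart_at M p) has_derivative D)
       (at (snd (chart_at M p) p))"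

lemma charted_smooth_manifold: "smooth_manifold M \<Longrightarrow> charted M"
  unfolding smooth_manifold_def charted_def by blast

lemma charted_vs: "charted vs_manifold"
  unfolding charted_def vs_manifold_def points_def by auto

lemma points_vs [simp]: "points vs_manifold = UNIV"
  unfolding vs_manifold_def points_def by simp

lemma chart_at_vs [simp]: "chart_at vs_manifold p = (UNIV, \<lambda>x. x)"
  unfolding vs_manifold_def by simp

lemma chart_inv_vs [simp]: "chart_inv (UNIV, \<lambda>x. x) = (\<lambda>x. x)"
  unfolding chart_inv_def by (simp add: inv_id[unfolded id_def])

lemma points_prod [simp]: "points (M \<times>\<^sub>M N) = points M \<times> points N"
  unfolding points_def prod_manifold_def by (force simp: prod_chart_def)

lemma chart_at_prod [simp]: "chart_at (M \<times>\<^sub>M N) (p, q) = prod_chart (chart_at M p) (chart_at N q)"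
  unfolding prod_manifold_def by simp

lemma chart_facts:
  assumes "charted M" "p \<in> points M"
  shows chart_in_atlas: "chart_at M p \<in> atlas M"
    and chart_dom: "p \<in> fst (chart_at M p)"
    and chart_inj: "inj_on (snd (chart_at M p)) (fst (chart_at M p))"
    and chart_open: "open (snd (chart_at M p) ` fst (chart_at M p))"
  using assms unfolding charted_def by (blast, blast, blast, metis Int_absorb)

lemma charted_prod:
  assumes "charted M" "charted N"
  shows "charted (M \<times>\<^sub>M N)"
proof -
  have im: "map_prod f g ` (A \<times> A' \<inter> B \<times> B') = (f ` (A \<inter> B)) \<times> (g ` (A' \<inter> B'))"
    for f :: "'a \<Rightarrow> 'b" and g :: "'c \<Rightarrow> 'd" and A B A' B'
    by (simp add: Times_Int_Times map_prod_surj_on[OF refl refl])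
  have at: "atlas (M \<times>\<^sub>M N) = {prod_chart c d | c d. c \<in> atlas M \<and> d \<in> atlas N}"
    by (simp add: prod_manifold_def)
  show ?thesis
    unfolding charted_def
  proof (intro conjI ballI)
    fix c assume "c \<in> atlas (M \<times>\<^sub>M N)"
    then show "inj_on (snd c) (fst c)"
      using assms unfolding at charted_def prod_chart_def by (force intro!: map_prod_inj_on)
  next
    fix c c' assume "c \<in> atlas (M \<times>\<^sub>M N)" "c' \<in> atlas (M \<times>\<^sub>M N)"
    then obtain a b a' b' where "a \<in> atlas M" "b \<in> atlas N" "a' \<in> atlas M" "b' \<in> atlas N"
      and c: "c = prod_chart a b" "c' = prod_chart a' b'"
      unfolding at by auto
    then have "open (snd a ` (fst a \<inter> fst a'))" "open (snd b ` (fst b \<inter> fst b'))"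
      using assms unfolding charted_def by blast+
    then show "open (snd c ` (fst c \<inter> fst c'))"
      unfolding c prod_chart_def by (simp add: im open_Times)
  next
    fix z assume z: "z \<in> points (M \<times>\<^sub>M N)"
    obtain p q where pq: "z = (p, q)" "p \<in> points M" "q \<in> points N" using z by auto
    then show "chart_at (M \<times>\<^sub>M N) z \<in> atlas (M \<times>\<^sub>M N)"
      unfolding at using chart_in_atlas[OF assms(1)] chart_in_atlas[OF assms(2)] by fastforce
    show "z \<in> fst (chart_at (M \<times>\<^sub>M N) z)"
      using pq chart_dom[OF assms(1)] chart_dom[OF assms(2)] by (simp add: prod_chart_def)
  qed
qed

lemma chart_inv_chart:
  assumes "charted M" "p \<in> points M" "x \<in> fst (chart_at M p)"
  shows "chart_inv (chart_at M p) (snd (chart_at M p) x) = x"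
  unfolding chart_inv_def using chart_inj[OF assms(1,2)] assms(3) by (simp add: inv_into_f_f)

lemma eventually_chart:
  assumes "charted M" "p \<in> points M"
  shows "\<forall>\<^sub>F x in nhds (snd (chart_at M p) p).
           chart_inv (chart_at M p) x \<in> fst (chart_at M p) \<and>
           snd (chart_at M p) (chart_inv (chart_at M p) x) = x"
proof -
  have "\<forall>\<^sub>F x in nhds (snd (chart_at M p) p). x \<in> snd (chart_at M p) ` fst (chart_at M p)"
    using chart_open[OF assms] chart_dom[OF assms] eventually_nhds by blast
  then show ?thesis
    by eventually_elim (simp add: chart_inv_def inv_into_into f_inv_into_f)
qed

lemma eventually_nbhds:
  "eventually P (nbhds M p) \<longleftrightarrow>
     (\<forall>\<^sub>F x in nhds (snd (chart_at M p) p). P (chart_inv (chart_at M p) x))"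
  unfolding nbhds_def by (simp add: eventually_filtermap)

lemma eventually_nbhds_open:
  assumes "charted M" "openin (mtop M) W" "p \<in> W"
  shows "\<forall>\<^sub>F x in nbhds M p. x \<in> W"
proof -
  have W: "W \<subseteq> points M" and op: "\<And>c. c \<in> atlas M \<Longrightarrow> open (snd c ` (W \<inter> fst c))"
    using assms(1,2) openin_mtop[of M W] unfolding charted_def by auto
  then have p: "p \<in> points M" using assms(3) by blast
  have "\<forall>\<^sub>F x in nhds (snd (chart_at M p) p). x \<in> snd (chart_at M p) ` (W \<inter> fst (chart_at M p))"
    using op[OF chart_in_atlas[OF assms(1) p]] chart_dom[OF assms(1) p] assms(3)
    by (intro eventually_nhds_in_open) auto
  then show ?thesis
    unfolding eventually_nbhds
    by eventually_elim (auto simp: chart_inv_chart[OF assms(1) p])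
qed

lemma openin_chart:
  assumes "charted M" "c \<in> atlas M"
  shows "openin (mtop M) (fst c)"
proof -
  have "openin (mtop M) (fst c) \<longleftrightarrow>
      fst c \<subseteq> points M \<and> (\<forall>d\<in>atlas M. open (snd d ` (fst c \<inter> fst d)))"
    using assms openin_mtop[of M "fst c"] unfolding charted_def by blast
  then show ?thesis
    using assms unfolding charted_def points_def by (auto simp: Int_commute)
qed

lemma eventually_nbhds_points:
  assumes "charted M" "p \<in> points M"
  shows "\<forall>\<^sub>F x in nbhds M p. x \<in> points M"
  using eventually_nbhds_open[OF assms(1) openin_chart[OF assms(1) chart_in_atlas[OF assms]]
      chart_dom[OF assms]]
  by eventually_elim (use chart_in_atlas[OF assms] in \<open>auto simp: points_def\<close>)

lemma has_tangentD: "has_tangent M N f p D \<Longrightarrow> tangent_map M N f p = D"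
  unfolding has_tangent_def tangent_map_def by (metis frechet_derivative_at)

lemma has_tangent_points: "has_tangent M N f p D \<Longrightarrow> p \<in> points M \<and> f p \<in> points N"
  unfolding has_tangent_def by simp

lemma has_tangent_linear: "has_tangent M N f p D \<Longrightarrow> linear D"
  unfolding has_tangent_def using has_derivative_linear by blast

lemma topspace_mtop:
  assumes "charted M"
  shows "topspace (mtop M) = points M"
proof -
  have *: "openin (mtop M) W \<longleftrightarrow> W \<subseteq> points M \<and> (\<forall>c\<in>atlas M. open (snd c ` (W \<inter> fst c)))" for W
    by (rule openin_mtop) (use assms in \<open>auto simp: charted_def\<close>)
  have "fst c \<subseteq> points M" if "c \<in> atlas M" for c using that unfolding points_def by blast
  then have "points M \<inter> fst c = fst c \<inter> fst c" if "c \<in> atlas M" for c using that by blast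
  moreover have "open (snd c ` (fst c \<inter> fst c))" if "c \<in> atlas M" for c
    using assms that unfolding charted_def by blast
  ultimately have "openin (mtop M) (points M)" unfolding * by auto
  then show ?thesis using * by (meson openin_subset openin_topspace subset_antisym)
qed

lemma has_tangent_smooth_on:
  assumes "charted M" "charted N" "smooth_map_on M N W f" "p \<in> W"
  shows "has_tangent M N f p (tangent_map M N f p)"
proof -
  have W: "openin (mtop M) W" and cont: "continuous_map (subtopology (mtop M) W) (mtop N) f"
    and sm: "\<And>c d. c \<in> atlas M \<Longrightarrow> d \<in> atlas N \<Longrightarrow>
        smooth_on (snd c ` {p \<in> W \<inter> fst c. f p \<in> fst d}) (snd d \<circ> f \<circ> chart_inv c)"
    using assms(3) unfolding smooth_map_on_def by auto
  have p: "p \<in> points M" using openin_subset[OF W] assms(4) topspace_mtop[OF assms(1)] by auto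
  have fp: "f p \<in> points N"
    using continuous_map_image_subset_topspace[OF cont] p assms(4)
      topspace_mtop[OF assms(1)] topspace_mtop[OF assms(2)] by auto
  let ?c = "chart_at M p" and ?d = "chart_at N (f p)"
  have "openin (mtop M) {x \<in> topspace (subtopology (mtop M) W). f x \<in> fst ?d}"
    using openin_continuous_map_preimage[OF cont openin_chart[OF assms(2) chart_in_atlas[OF assms(2) fp]]]
      W openin_trans_full by blast
  from eventually_nbhds_open[OF assms(1) this, of p]
  have near: "\<forall>\<^sub>F x in nbhds M p. f x \<in> fst ?d"
    using p assms(4) chart_dom[OF assms(2) fp] topspace_mtop[OF assms(1)]
    by (auto elim: eventually_mono)
  have "Ck_on (Suc 0) (snd ?c ` {p \<in> W \<inter> fst ?c. f p \<in> fst ?d}) (snd ?d \<circ> f \<circ> chart_inv ?c)"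
    using sm[OF chart_in_atlas[OF assms(1) p] chart_in_atlas[OF assms(2) fp]]
    unfolding smooth_on_def by blast
  then have "(snd ?d \<circ> f \<circ> chart_inv ?c) differentiable (at (snd ?c p))"
    using assms(4) chart_dom[OF assms(1) p] chart_dom[OF assms(2) fp] by auto
  then show ?thesis
    unfolding has_tangent_def tangent_map_def using p fp near frechet_derivative_works by blast
qed

lemma has_tangent_smooth:
  assumes "charted M" "charted N" "smooth_map M N f" "p \<in> points M"
  shows "has_tangent M N f p (tangent_map M N f p)"
  by (rule has_tangent_smooth_on[OF assms(1,2) assms(3)[unfolded smooth_map_def] assms(4)])

text \<open>
  Differentiability implies continuity.  This is what allows local statements about the target to be
  pulled back.
\<close>

lemma has_tangent_filterlim:
  assumes N: "charted N" and f: "has_tangent M N f p D" and M: "charted M"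
  shows "filterlim f (nbhds N (f p)) (nbhds M p)"
  unfolding filterlim_iff
proof (intro allI impI)
  fix P assume P: "eventually P (nbhds N (f p))"
  let ?c = "chart_at M p" and ?d = "chart_at N (f p)"
  have fp: "f p \<in> points N" and p: "p \<in> points M"
    and ev: "\<forall>\<^sub>F x in nhds (snd ?c p). f (chart_inv ?c x) \<in> fst ?d"
    and der: "(snd ?d \<circ> f \<circ> chart_inv ?c has_derivative D) (at (snd ?c p))"
    using f unfolding has_tangent_def eventually_nbhds by auto
  have "filterlim (snd ?d \<circ> f \<circ> chart_inv ?c) (nhds (snd ?d (f p))) (nhds (snd ?c p))"
    using has_derivative_continuous[OF der] chart_inv_chart[OF M p chart_dom[OF M p]]
    unfolding isCont_def tendsto_at_iff_tendsto_nhds by simp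
  then have "\<forall>\<^sub>F x in nhds (snd ?c p). P (chart_inv ?d (snd ?d (f (chart_inv ?c x))))"
    using P unfolding eventually_nbhds filterlim_iff by auto
  with ev show "\<forall>\<^sub>F x in nbhds M p. P (f x)"
    unfolding eventually_nbhds
    by eventually_elim (simp add: chart_inv_chart[OF N fp])
qed

lemma has_tangent_eventually:
  assumes "charted M" "charted N" "has_tangent M N f p D" "eventually P (nbhds N (f p))"
  shows "\<forall>\<^sub>F x in nbhds M p. P (f x)"
  using has_tangent_filterlim[OF assms(2,3,1)] assms(4) unfolding filterlim_iff by blast

lemma eventually_nbhds_self:
  assumes "charted M" "p \<in> points M" "eventually P (nbhds M p)"
  shows "P p"
  using eventually_nhds_x_imp_x[OF assms(3)[unfolded eventually_nbhds]]
    chart_inv_chart[OF assms(1,2) chart_dom[OF assms(1,2)]] by simp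

text \<open>
  The chain rule.  The inner chart of \<open>N\<close> cancels because both coordinate expressions use the same
  preferred chart, the one at \<open>f p\<close>; no change of charts enters.
\<close>

lemma has_tangent_compose:
  assumes M: "charted M" and N: "charted N"
    and f: "has_tangent M N f p D" and g: "has_tangent N P g (f p) E"
  shows "has_tangent M P (\<lambda>x. g (f x)) p (\<lambda>v. E (D v))"
proof -
  let ?c = "chart_at M p" and ?d = "chart_at N (f p)" and ?e = "chart_at P (g (f p))"
  have p: "p \<in> points M" and fp: "f p \<in> points N" and gp: "g (f p) \<in> points P"
    and ev: "\<forall>\<^sub>F x in nhds (snd ?c p). f (chart_inv ?c x) \<in> fst ?d"
    and derf: "(snd ?d \<circ> f \<circ> chart_inv ?c has_derivative D) (at (snd ?c p))"
    and derg: "(snd ?e \<circ> g \<circ> chart_inv ?d has_derivative E) (at (snd ?d (f p)))"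
    using f g unfolding has_tangent_def eventually_nbhds by auto
  have near: "\<forall>\<^sub>F x in nbhds M p. g (f x) \<in> fst ?e"
    by (rule has_tangent_eventually[OF M N f]) (use g in \<open>simp add: has_tangent_def\<close>)
  have "((snd ?e \<circ> g \<circ> chart_inv ?d) \<circ> (snd ?d \<circ> f \<circ> chart_inv ?c) has_derivative (E \<circ> D))
      (at (snd ?c p))"
    using derf derg chart_inv_chart[OF M p chart_dom[OF M p]]
    by (intro diff_chain_at) auto
  then have "(snd ?e \<circ> (\<lambda>x. g (f x)) \<circ> chart_inv ?c has_derivative (\<lambda>v. E (D v))) (at (snd ?c p))"
    unfolding o_def
  proof (rule has_derivative_transform_eventually)
    show "\<forall>\<^sub>F x in at (snd ?c p). snd ?e (g (chart_inv ?d (snd ?d (f (chart_inv ?c x))))) =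
            snd ?e (g (f (chart_inv ?c x)))"
      using ev unfolding eventually_at_filter
      by eventually_elim (simp add: chart_inv_chart[OF N fp])
  qed (use chart_inv_chart[OF M p chart_dom[OF M p]] chart_inv_chart[OF N fp chart_dom[OF N fp]] in auto)
  then show ?thesis
    using p gp near unfolding has_tangent_def by simp
qed

lemma has_tangent_cong:
  assumes M: "charted M" and f: "has_tangent M N f p D" and eq: "\<forall>\<^sub>F x in nbhds M p. f x = g x"
  shows "has_tangent M N g p D"
proof -
  let ?c = "chart_at M p"
  have p: "p \<in> points M" using f unfolding has_tangent_def by blast
  have gp: "g p = f p" using eventually_nbhds_self[OF M p eq] by simp
  have near: "\<forall>\<^sub>F x in nbhds M p. g x \<in> fst (chart_at N (f p))"
    using f[unfolded has_tangent_def, THEN conjunct2, THEN conjunct2, THEN conjunct1] eq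
    by eventually_elim simp
  have der: "(snd (chart_at N (f p)) \<circ> f \<circ> chart_inv ?c has_derivative D) (at (snd ?c p))"
    using f unfolding has_tangent_def by blast
  have "(snd (chart_at N (f p)) \<circ> g \<circ> chart_inv ?c has_derivative D) (at (snd ?c p))"
    using der
  proof (rule has_derivative_transform_eventually)
    show "\<forall>\<^sub>F x in at (snd ?c p). (snd (chart_at N (f p)) \<circ> f \<circ> chart_inv ?c) x =
            (snd (chart_at N (f p)) \<circ> g \<circ> chart_inv ?c) x"
      using eq unfolding eventually_at_filter eventually_nbhds by (auto elim: eventually_mono)
  qed (use gp chart_inv_chart[OF M p chart_dom[OF M p]] in auto)
  then show ?thesis using f near gp unfolding has_tangent_def by simp
qed

lemma has_tangent_Pair:
  assumes f: "has_tangent M N f p D" and g: "has_tangent M P g p E"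
  shows "has_tangent M (N \<times>\<^sub>M P) (\<lambda>x. (f x, g x)) p (\<lambda>v. (D v, E v))"
proof -
  have "\<forall>\<^sub>F x in nbhds M p. f x \<in> fst (chart_at N (f p)) \<and> g x \<in> fst (chart_at P (g p))"
    using f g unfolding has_tangent_def by (simp add: eventually_conj)
  moreover have "(snd (chart_at N (f p)) \<circ> f \<circ> chart_inv (chart_at M p) has_derivative D)
      (at (snd (chart_at M p) p))"
    and "(snd (chart_at P (g p)) \<circ> g \<circ> chart_inv (chart_at M p) has_derivative E)
      (at (snd (chart_at M p) p))"
    using f g unfolding has_tangent_def by blast+
  note has_derivative_Pair[OF this]
  ultimately show ?thesis
    using f g unfolding has_tangent_def by (simp add: prod_chart_def o_def)
qed

lemma has_tangent_id:
  assumes M: "charted M" and p: "p \<in> points M"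
  shows "has_tangent M M (\<lambda>x. x) p (\<lambda>v. v)"
proof -
  let ?c = "chart_at M p"
  have "((\<lambda>x. x) has_derivative (\<lambda>v. v)) (at (snd ?c p))" by (rule has_derivative_ident)
  then have "(snd ?c \<circ> (\<lambda>x. x) \<circ> chart_inv ?c has_derivative (\<lambda>v. v)) (at (snd ?c p))"
  proof (rule has_derivative_transform_eventually)
    show "\<forall>\<^sub>F x in at (snd ?c p). x = (snd ?c \<circ> (\<lambda>x. x) \<circ> chart_inv ?c) x"
      using eventually_chart[OF M p] unfolding eventually_at_filter by (auto elim: eventually_mono)
  qed (use chart_inv_chart[OF M p chart_dom[OF M p]] in auto)
  then show ?thesis
    using p eventually_chart[OF M p] unfolding has_tangent_def eventually_nbhds
    by (auto elim: eventually_mono)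
qed

lemma has_tangent_const:
  assumes "charted N" "p \<in> points M" "y \<in> points N"
  shows "has_tangent M N (\<lambda>x. y) p (\<lambda>v. 0)"
  using assms chart_dom[OF assms(1,3)] unfolding has_tangent_def by (simp add: o_def)

lemma has_tangent_fst:
  assumes M: "charted M" and N: "charted N" and p: "p \<in> points M" and q: "q \<in> points N"
  shows "has_tangent (M \<times>\<^sub>M N) M fst (p, q) fst"
proof -
  let ?c = "prod_chart (chart_at M p) (chart_at N q)"
  have ev: "\<forall>\<^sub>F z in nhds (snd ?c (p, q)). fst (chart_inv ?c z) \<in> fst (chart_at M p) \<and>
      snd (chart_at M p) (fst (chart_inv ?c z)) = fst z"
    using eventually_chart[OF charted_prod[OF M N], of "(p, q)"] p q
    by (auto elim!: eventually_mono simp: prod_chart_def split: prod.splits)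
  have inv: "chart_inv ?c (snd ?c (p, q)) = (p, q)"
    using chart_inv_chart[OF charted_prod[OF M N], of "(p, q)" "(p, q)"]
      chart_dom[OF charted_prod[OF M N], of "(p, q)"] p q by simp
  have "(fst has_derivative fst) (at (snd ?c (p, q)))" by (intro derivative_intros)
  then have "(snd (chart_at M p) \<circ> fst \<circ> chart_inv ?c has_derivative fst) (at (snd ?c (p, q)))"
  proof (rule has_derivative_transform_eventually)
    show "\<forall>\<^sub>F z in at (snd ?c (p, q)). fst z = (snd (chart_at M p) \<circ> fst \<circ> chart_inv ?c) z"
      using ev unfolding eventually_at_filter by (auto elim: eventually_mono)
  qed (use inv in \<open>auto simp: prod_chart_def\<close>)
  then show ?thesis
    using p q ev unfolding has_tangent_def eventually_nbhds by (auto elim: eventually_mono)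
qed

lemma has_tangent_snd:
  assumes M: "charted M" and N: "charted N" and p: "p \<in> points M" and q: "q \<in> points N"
  shows "has_tangent (M \<times>\<^sub>M N) N snd (p, q) snd"
proof -
  let ?c = "prod_chart (chart_at M p) (chart_at N q)"
  have ev: "\<forall>\<^sub>F z in nhds (snd ?c (p, q)). snd (chart_inv ?c z) \<in> fst (chart_at N q) \<and>
      snd (chart_at N q) (snd (chart_inv ?c z)) = snd z"
    using eventually_chart[OF charted_prod[OF M N], of "(p, q)"] p q
    by (auto elim!: eventually_mono simp: prod_chart_def split: prod.splits)
  have inv: "chart_inv ?c (snd ?c (p, q)) = (p, q)"
    using chart_inv_chart[OF charted_prod[OF M N], of "(p, q)" "(p, q)"]
      chart_dom[OF charted_prod[OF M N], of "(p, q)"] p q by simp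
  have "(snd has_derivative snd) (at (snd ?c (p, q)))" by (intro derivative_intros)
  then have "(snd (chart_at N q) \<circ> snd \<circ> chart_inv ?c has_derivative snd) (at (snd ?c (p, q)))"
  proof (rule has_derivative_transform_eventually)
    show "\<forall>\<^sub>F z in at (snd ?c (p, q)). snd z = (snd (chart_at N q) \<circ> snd \<circ> chart_inv ?c) z"
      using ev unfolding eventually_at_filter by (auto elim: eventually_mono)
  qed (use inv in \<open>auto simp: prod_chart_def\<close>)
  then show ?thesis
    using p q ev unfolding has_tangent_def eventually_nbhds by (auto elim: eventually_mono)
qed

lemma has_tangent_vs_iff:
  "has_tangent vs_manifold vs_manifold f x D \<longleftrightarrow> (f has_derivative D) (at x)"
  unfolding has_tangent_def eventually_nbhds by (simp add: o_def)

lemma has_tangent_tangent_map: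
  "has_tangent M N f p D \<Longrightarrow> has_tangent M N f p (tangent_map M N f p)"
  by (simp add: has_tangentD)

lemma has_tangent_unique:
  "has_tangent M N f p D \<Longrightarrow> has_tangent M N f p E \<Longrightarrow> D = E"
  by (metis has_tangentD)

lemma has_tangent_compose2:
  assumes "charted M" "charted N" "charted P"
    and "has_tangent M N f p D" "has_tangent M P g p E"
    and "has_tangent (N \<times>\<^sub>M P) R F (f p, g p) K"
  shows "has_tangent M R (\<lambda>x. F (f x, g x)) p (\<lambda>v. K (D v, E v))"
  using has_tangent_compose[OF assms(1) charted_prod[OF assms(2,3)]
      has_tangent_Pair[OF assms(4,5)] assms(6)] .

text \<open>Partial tangent maps arise by composing with the slice inclusions \<open>x' \<mapsto> (x', y)\<close> and \<open>y' \<mapsto> (x, y')\<close>.\<close>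

lemma has_tangent_partial1:
  assumes "charted M" "charted N" "has_tangent (M \<times>\<^sub>M N) P F (x, y) D"
  shows "has_tangent M P (\<lambda>x'. F (x', y)) x (\<lambda>u. D (u, 0))"
proof -
  have "x \<in> points M" "y \<in> points N" using has_tangent_points[OF assms(3)] by auto
  then show ?thesis
    using has_tangent_compose2[OF assms(1,1,2) has_tangent_id has_tangent_const assms(3)] assms by blast
qed

lemma has_tangent_partial2:
  assumes "charted M" "charted N" "has_tangent (M \<times>\<^sub>M N) P F (x, y) D"
  shows "has_tangent N P (\<lambda>y'. F (x, y')) y (\<lambda>v. D (0, v))"
proof -
  have "x \<in> points M" "y \<in> points N" using has_tangent_points[OF assms(3)] by auto
  then show ?thesis
    using has_tangent_compose2[OF assms(2,1,2) has_tangent_const has_tangent_id assms(3)] assms by blast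
qed

lemma linear_split: "linear D \<Longrightarrow> D (u, v) = D (u, 0) + D (0, v)"
  by (metis add.left_neutral add.right_neutral add_Pair linear_add)

lemma D1_eq:
  assumes "charted M" "charted N" "has_tangent (M \<times>\<^sub>M N) vs_manifold F (x, y) D"
  shows "D1 M F (x, y) u = D (u, 0)"
  using has_tangentD[OF has_tangent_partial1[OF assms]] by (simp add: D1_def)

lemma D2_eq:
  assumes "charted M" "charted N" "has_tangent (M \<times>\<^sub>M N) vs_manifold F (x, y) D"
  shows "D2 N F (x, y) v = D (0, v)"
  using has_tangentD[OF has_tangent_partial2[OF assms]] by (simp add: D2_def)

section \<open>Variations of discrete curves\<close>

text \<open>The lines by which discrete curves are deformed have the prescribed velocity.\<close>

lemma has_tangent_chart_line:
  assumes M: "charted M" and p: "p \<in> points M"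
  defines "c \<equiv> chart_at M p"
  shows "has_tangent (vs_manifold :: (real, real) manifold) M
           (\<lambda>t. chart_inv c (snd c p + t *\<^sub>R v)) 0 (\<lambda>t. t *\<^sub>R v)"
proof -
  have lim: "((\<lambda>t::real. snd c p + t *\<^sub>R v) \<longlongrightarrow> snd c p) (nhds 0)"
    by (rule tendsto_eq_intros refl filterlim_ident | simp)+
  have inv: "chart_inv c (snd c p) = p"
    unfolding c_def by (rule chart_inv_chart[OF M p chart_dom[OF M p]])
  have ev: "\<forall>\<^sub>F t in nhds (0::real). chart_inv c (snd c p + t *\<^sub>R v) \<in> fst c \<and>
      snd c (chart_inv c (snd c p + t *\<^sub>R v)) = snd c p + t *\<^sub>R v"
    using eventually_compose_filterlim[OF eventually_chart[OF M p] lim[unfolded c_def]]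
    unfolding c_def .
  have "((\<lambda>t::real. snd c p + t *\<^sub>R v) has_derivative (\<lambda>t. t *\<^sub>R v)) (at 0)"
    by (auto intro!: derivative_eq_intros)
  then have "((\<lambda>t. snd c (chart_inv c (snd c p + t *\<^sub>R v))) has_derivative (\<lambda>t. t *\<^sub>R v)) (at 0)"
  proof (rule has_derivative_transform_eventually)
    show "\<forall>\<^sub>F t in at (0::real). snd c p + t *\<^sub>R v = snd c (chart_inv c (snd c p + t *\<^sub>R v))"
      using ev unfolding eventually_at_filter by (auto elim: eventually_mono)
  qed (use inv in auto)
  moreover have "\<forall>\<^sub>F t in nhds (0::real). chart_inv c (snd c p + t *\<^sub>R v) \<in> fst c"
    using ev by eventually_elim simp
  ultimately show ?thesis
    using p inv unfolding has_tangent_def eventually_nbhds by (simp add: o_def c_def[symmetric])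
qed

lemma curve_differential_action_sum:
  assumes M: "charted M"
    and F: "\<And>k. k < N \<Longrightarrow> \<exists>D. has_tangent (M \<times>\<^sub>M M) vs_manifold F (q k, q (Suc k)) D"
  shows "curve_differential M (action_sum F N) q dq =
    (\<Sum>k<N. D1 M F (q k, q (Suc k)) (dq k) + D2 M F (q k, q (Suc k)) (dq (Suc k)))"
proof -
  have "((\<lambda>t. F (curve_deformation M q dq t k, curve_deformation M q dq t (Suc k)))
      has_field_derivative D1 M F (q k, q (Suc k)) (dq k) + D2 M F (q k, q (Suc k)) (dq (Suc k))) (at 0)"
    if k: "k < N" for k
  proof -
    obtain D where D: "has_tangent (M \<times>\<^sub>M M) vs_manifold F (q k, q (Suc k)) D"
      using F[OF k] by blast
    have p: "q k \<in> points M" "q (Suc k) \<in> points M" using has_tangent_points[OF D] by auto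
    have inv: "chart_inv (chart_at M p) (snd (chart_at M p) p) = p" if "p \<in> points M" for p
      by (rule chart_inv_chart[OF M that chart_dom[OF M that]])
    have "has_tangent vs_manifold vs_manifold
        (\<lambda>t. F (curve_deformation M q dq t k, curve_deformation M q dq t (Suc k))) 0
        (\<lambda>t::real. D (t *\<^sub>R dq k, t *\<^sub>R dq (Suc k)))"
      unfolding curve_deformation_def
      by (rule has_tangent_compose2[OF charted_vs M M has_tangent_chart_line[OF M p(1)]
            has_tangent_chart_line[OF M p(2)]]) (use D inv p in simp)
    then have "((\<lambda>t. F (curve_deformation M q dq t k, curve_deformation M q dq t (Suc k)))
        has_derivative (\<lambda>t::real. D (t *\<^sub>R dq k, t *\<^sub>R dq (Suc k)))) (at 0)"
      by (simp only: has_tangent_vs_iff)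
    moreover have "D (t *\<^sub>R dq k, t *\<^sub>R dq (Suc k)) =
        (D1 M F (q k, q (Suc k)) (dq k) + D2 M F (q k, q (Suc k)) (dq (Suc k))) * t" for t
      unfolding D1_eq[OF M M D] D2_eq[OF M M D] linear_split[OF has_tangent_linear[OF D], symmetric]
      using linear_scale[OF has_tangent_linear[OF D], of t "(dq k, dq (Suc k))"] by simp
    ultimately show ?thesis by (simp add: has_field_derivative_def)
  qed
  then have "((\<lambda>t. action_sum F N (curve_deformation M q dq t)) has_field_derivative
      (\<Sum>k<N. D1 M F (q k, q (Suc k)) (dq k) + D2 M F (q k, q (Suc k)) (dq (Suc k)))) (at 0)"
    unfolding action_sum_def by (intro DERIV_sum) auto
  then show ?thesis unfolding curve_differential_def by (rule DERIV_imp_deriv)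
qed

text \<open>
  The discrete counterpart of the fundamental lemma of the calculus of variations: shifting the index
  collects, for each interior vertex, the two terms that depend on its variation, and these
  variations can be chosen independently of each other.
\<close>

lemma discrete_fundamental_lemma:
  fixes a b :: "nat \<Rightarrow> 'v::zero \<Rightarrow> real"
  assumes zero: "\<And>k. k < N \<Longrightarrow> a k 0 = 0" "\<And>k. k < N \<Longrightarrow> b k 0 = 0"
  shows "(\<forall>d. d 0 = 0 \<and> d N = 0 \<longrightarrow> (\<Sum>k<N. a k (d k) + b k (d (Suc k))) = 0) \<longleftrightarrow>
    (\<forall>k. 1 \<le> k \<and> k < N \<longrightarrow> (\<forall>v. b (k - 1) v + a k v = 0))"
proof (cases N)
  case (Suc n)
  have parts: "(\<Sum>k<N. a k (d k) + b k (d (Suc k))) = (\<Sum>k<n. b k (d (Suc k)) + a (Suc k) (d (Suc k)))"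
    if "d 0 = 0" "d N = 0" for d :: "nat \<Rightarrow> 'v"
  proof -
    have "(\<Sum>k<N. a k (d k)) = (\<Sum>k<n. a (Suc k) (d (Suc k)))"
      unfolding Suc sum.lessThan_Suc_shift using that(1) zero(1) Suc by simp
    moreover have "(\<Sum>k<N. b k (d (Suc k))) = (\<Sum>k<n. b k (d (Suc k)))"
      using that(2) zero(2) Suc by simp
    ultimately show ?thesis by (simp add: sum.distrib)
  qed
  show ?thesis
  proof (intro iffI allI impI)
    fix k v
    assume all: "\<forall>d. d 0 = 0 \<and> d N = 0 \<longrightarrow> (\<Sum>k<N. a k (d k) + b k (d (Suc k))) = 0"
      and k: "1 \<le> k \<and> k < N"
    then obtain j where j: "k = Suc j" "j < n" using Suc by (cases k) auto
    define d :: "nat \<Rightarrow> 'v" where "d i = (if i = k then v else 0)" for i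
    have "d 0 = 0" "d N = 0" using k by (auto simp: d_def)
    then have "0 = (\<Sum>i<n. b i (d (Suc i)) + a (Suc i) (d (Suc i)))"
      using all parts[of d] by simp
    also have "\<dots> = (\<Sum>i<n. if i = j then b j v + a k v else 0)"
      by (rule sum.cong) (use j zero Suc in \<open>auto simp: d_def\<close>)
    finally show "b (k - 1) v + a k v = 0" using j by simp
  next
    fix d :: "nat \<Rightarrow> 'v"
    assume el: "\<forall>k. 1 \<le> k \<and> k < N \<longrightarrow> (\<forall>v. b (k - 1) v + a k v = 0)" and d: "d 0 = 0 \<and> d N = 0"
    have "b k v + a (Suc k) v = 0" if "k < n" for k v
      using el[rule_format, of "Suc k" v] that Suc by simp
    then show "(\<Sum>k<N. a k (d k) + b k (d (Suc k))) = 0" using parts[of d] d by simp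
  qed
qed simp

section \<open>Lie groups\<close>

lemma lie_group_charted: "lie_group G MG \<Longrightarrow> charted MG"
  using charted_smooth_manifold unfolding lie_group_def by blast

lemma lie_group_has_tangent_mult:
  assumes G: "lie_group G MG" and M: "charted M"
    and a: "has_tangent M MG a p D" and b: "has_tangent M MG b p E"
  shows "\<exists>D. has_tangent M MG (\<lambda>m. a m \<otimes>\<^bsub>G\<^esub> b m) p D"
proof -
  note MG = lie_group_charted[OF G]
  have "has_tangent (MG \<times>\<^sub>M MG) MG (\<lambda>(g, h). g \<otimes>\<^bsub>G\<^esub> h) (a p, b p)
      (tangent_map (MG \<times>\<^sub>M MG) MG (\<lambda>(g, h). g \<otimes>\<^bsub>G\<^esub> h) (a p, b p))"
    using G has_tangent_points[OF a] has_tangent_points[OF b] unfolding lie_group_def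
    by (intro has_tangent_smooth charted_prod MG) auto
  from has_tangent_compose2[OF M MG MG a b this] show ?thesis by auto
qed

text \<open>Conjugation is differentiable, so the tangent map that defines \<open>Ad\<close> is a true derivative.\<close>

lemma lie_group_has_tangent_Ad:
  assumes G: "lie_group G MG" and g: "g \<in> carrier G"
  shows "has_tangent MG MG (\<lambda>h. g \<otimes>\<^bsub>G\<^esub> h \<otimes>\<^bsub>G\<^esub> inv\<^bsub>G\<^esub> g) \<one>\<^bsub>G\<^esub> (Ad G MG g)"
proof -
  note MG = lie_group_charted[OF G]
  interpret group G using G unfolding lie_group_def by blast
  have carrier: "carrier G = points MG" using G unfolding lie_group_def by blast
  have one: "\<one>\<^bsub>G\<^esub> \<in> points MG" using one_closed carrier by simp
  have const: "has_tangent MG MG (\<lambda>h. k) \<one>\<^bsub>G\<^esub> (\<lambda>\<xi>. 0)" if "k \<in> carrier G" for k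
    using has_tangent_const[OF MG one] that carrier by simp
  obtain D where "has_tangent MG MG (\<lambda>h. g \<otimes>\<^bsub>G\<^esub> h) \<one>\<^bsub>G\<^esub> D"
    using lie_group_has_tangent_mult[OF G MG const[OF g] has_tangent_id[OF MG one]] by blast
  from lie_group_has_tangent_mult[OF G MG this const[OF inv_closed[OF g]]]
  obtain E where "has_tangent MG MG (\<lambda>h. g \<otimes>\<^bsub>G\<^esub> h \<otimes>\<^bsub>G\<^esub> inv\<^bsub>G\<^esub> g) \<one>\<^bsub>G\<^esub> E" ..
  then show ?thesis unfolding Ad_def by (rule has_tangent_tangent_map)
qed

section \<open>Reduction by a symmetry group\<close>

text \<open>
  \<open>H\<close> is the group \<open>G\<^sub>\<mu>\<close> and \<open>\<nu>\<close> the restriction of \<open>\<mu>\<close> to its Lie algebra.  What remains of the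
  ambient group is its action, the invariance of \<open>L\<close> and the invariance of \<open>\<nu>\<close> under \<open>Ad\<close>, all
  restricted to \<open>H\<close>.  The last one holds because \<open>H\<close> is the isotropy group of \<open>\<mu>\<close>.
\<close>

locale symmetry_reduction =
  fixes Q :: "('q, 'e::real_normed_vector) manifold"
    and H :: "'g monoid"
    and MH :: "('g, 'h::real_normed_vector) manifold"
    and B :: "('q set, 'b::real_normed_vector) manifold"
    and l :: "'g \<Rightarrow> 'q \<Rightarrow> 'q"
    and L :: "'q \<times> 'q \<Rightarrow> real"
    and \<nu> :: "'h \<Rightarrow> real"
    and \<AA> :: "'q \<Rightarrow> 'e \<Rightarrow> 'h"
    and J A
  defines "J \<equiv> momentum_map H MH Q l L"
    and "A \<equiv> affine_connection H l J \<nu>"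
  assumes Q: "charted Q"
    and L_smooth: "smooth_map (Q \<times>\<^sub>M Q) vs_manifold L"
    and H: "lie_group H MH"
    and act: "group_action H (points Q) l"
    and act_tangent: "\<And>g q. g \<in> carrier H \<Longrightarrow> q \<in> points Q \<Longrightarrow>
      \<exists>D. has_tangent (MH \<times>\<^sub>M Q) Q (\<lambda>(g, q). l g q) (g, q) D"
    and L_invariant:
      "\<And>g q0 q1. g \<in> carrier H \<Longrightarrow> q0 \<in> points Q \<Longrightarrow> q1 \<in> points Q \<Longrightarrow> L (l g q0, l g q1) = L (q0, q1)"
    and \<nu>_Ad: "\<And>g \<xi>. g \<in> carrier H \<Longrightarrow> \<nu> (Ad H MH g \<xi>) = \<nu> \<xi>"
    and quotient: "quotient_principal_bundle H MH Q l B"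
    and A_ex1: "\<And>q0 q1. q0 \<in> points Q \<Longrightarrow> q1 \<in> points Q \<Longrightarrow>
      \<exists>!g. g \<in> carrier H \<and> J (q0, l (inv\<^bsub>H\<^esub> g) q1) = \<nu>"
    and A_smooth: "smooth_map (Q \<times>\<^sub>M Q) MH A"
    and connection: "principal_connection H MH Q l \<AA>"
begin

sublocale H: group H
  using H unfolding lie_group_def by blast

abbreviation "\<pi> \<equiv> orbit H l"
abbreviation "hdisc \<equiv> discrete_lift Q \<pi> J \<nu>"
abbreviation "hlift \<equiv> horizontal_lift Q B \<pi> \<AA>"
abbreviation "Lc \<equiv> check_lagrangian l hdisc L"
abbreviation "Lr \<equiv> reduced_lagrangian H Q \<pi> Lc"
abbreviation "f \<equiv> reduced_force H MH Q \<pi> hdisc hlift A Lc"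

lemma MH: "charted MH" and carrier_H: "carrier H = points MH"
  using H charted_smooth_manifold unfolding lie_group_def by blast+

lemma B: "charted B"
  using quotient charted_smooth_manifold unfolding quotient_principal_bundle_def by blast

lemmas charts = Q MH B charted_vs charted_prod

lemma act_closed [simp]: "g \<in> carrier H \<Longrightarrow> q \<in> points Q \<Longrightarrow> l g q \<in> points Q"
  using group_action.element_image[OF act] by blast

lemma act_mult: "g \<in> carrier H \<Longrightarrow> h \<in> carrier H \<Longrightarrow> q \<in> points Q \<Longrightarrow> l (g \<otimes>\<^bsub>H\<^esub> h) q = l g (l h q)"
  using group_action.composition_rule[OF act] by blast

lemma act_one [simp]: "q \<in> points Q \<Longrightarrow> l \<one>\<^bsub>H\<^esub> q = q"
  using group_action.id_eq_one[OF act] by (metis restrict_apply')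

lemma act_inv [simp]: "g \<in> carrier H \<Longrightarrow> q \<in> points Q \<Longrightarrow> l g (l (inv\<^bsub>H\<^esub> g) q) = q"
  using act_mult[of g "inv\<^bsub>H\<^esub> g" q] by simp

lemma orbit_memD: "x \<in> \<pi> q \<Longrightarrow> \<exists>g\<in>carrier H. x = l g q"
  unfolding orbit_def by auto

lemma orbit_self: "q \<in> points Q \<Longrightarrow> q \<in> \<pi> q"
  unfolding orbit_def using act_one[of q] by (force intro: exI[of _ "\<one>\<^bsub>H\<^esub>"])

lemma orbit_act [simp]:
  assumes "g \<in> carrier H" "q \<in> points Q"
  shows "\<pi> (l g q) = \<pi> q"
proof -
  have "\<exists>k. l h (l g q) = l k q \<and> k \<in> carrier H" if "h \<in> carrier H" for h
    using act_mult[of h g q] assms that by (metis H.m_closed)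
  moreover have "\<exists>k. l h q = l k (l g q) \<and> k \<in> carrier H" if "h \<in> carrier H" for h
    using act_mult[of "h \<otimes>\<^bsub>H\<^esub> inv\<^bsub>H\<^esub> g" g q] assms that
    by (metis H.inv_closed H.inv_solve_right H.m_closed)
  ultimately show ?thesis unfolding orbit_def by blast
qed

lemma orbit_eqD:
  assumes "q0 \<in> points Q" "q1 \<in> points Q" "\<pi> q0 = \<pi> q1"
  obtains g where "g \<in> carrier H" "q1 = l g q0"
  using orbit_memD[of q1 q0] orbit_self[of q1] assms by auto

lemma orbit_points: "q \<in> points Q \<Longrightarrow> \<pi> q \<in> points B"
  using quotient unfolding quotient_principal_bundle_def orbits_def by auto

lemma has_tangent_act:
  assumes "charted M" "has_tangent M MH a p D" "has_tangent M Q x p E"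
  shows "has_tangent M Q (\<lambda>m. l (a m) (x m)) p
           (\<lambda>v. tangent_map (MH \<times>\<^sub>M Q) Q (\<lambda>(g, q). l g q) (a p, x p) (D v, E v))"
proof -
  obtain K where K: "has_tangent (MH \<times>\<^sub>M Q) Q (\<lambda>(g, q). l g q) (a p, x p) K"
    using act_tangent has_tangent_points[OF assms(2)] has_tangent_points[OF assms(3)]
    by (metis carrier_H)
  from has_tangent_compose2[OF assms(1) MH Q assms(2,3) has_tangent_tangent_map[OF K]]
  show ?thesis by simp
qed

lemmas has_tangent_mult = lie_group_has_tangent_mult[OF H]

lemma has_tangent_inv:
  assumes "charted M" "has_tangent M MH a p D"
  shows "\<exists>D. has_tangent M MH (\<lambda>m. inv\<^bsub>H\<^esub> (a m)) p D"
proof -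
  have "has_tangent MH MH (\<lambda>g. inv\<^bsub>H\<^esub> g) (a p) (tangent_map MH MH (\<lambda>g. inv\<^bsub>H\<^esub> g) (a p))"
    using H has_tangent_points[OF assms(2)] unfolding lie_group_def
    by (intro has_tangent_smooth charts) auto
  from has_tangent_compose[OF assms(1) MH assms(2) this] show ?thesis by blast
qed

lemma has_tangent_L:
  "q0 \<in> points Q \<Longrightarrow> q1 \<in> points Q \<Longrightarrow>
     has_tangent (Q \<times>\<^sub>M Q) vs_manifold L (q0, q1) (tangent_map (Q \<times>\<^sub>M Q) vs_manifold L (q0, q1))"
  by (intro has_tangent_smooth charts L_smooth) auto

lemma has_tangent_A:
  "q0 \<in> points Q \<Longrightarrow> q1 \<in> points Q \<Longrightarrow>
     has_tangent (Q \<times>\<^sub>M Q) MH A (q0, q1) (tangent_map (Q \<times>\<^sub>M Q) MH A (q0, q1))"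
  by (intro has_tangent_smooth charts A_smooth) auto

lemma has_tangent_orbit:
  "q \<in> points Q \<Longrightarrow> has_tangent Q B \<pi> q (tangent_map Q B \<pi> q)"
  using quotient unfolding quotient_principal_bundle_def by (intro has_tangent_smooth charts) auto

lemma has_tangent_translation:
  assumes "g \<in> carrier H" "q \<in> points Q"
  shows "has_tangent Q Q (l g) q (tangent_map Q Q (l g) q)"
  using has_tangent_act[OF Q has_tangent_const[OF MH] has_tangent_id[OF Q]] assms
  by (intro has_tangent_tangent_map) (auto simp: carrier_H)

lemma has_tangent_orbit_map:
  assumes "q \<in> points Q"
  shows "has_tangent MH Q (\<lambda>g. l g q) \<one>\<^bsub>H\<^esub> (\<lambda>\<xi>. inf_gen H MH Q l \<xi> q)"
  unfolding inf_gen_def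
  using has_tangent_act[OF MH has_tangent_id[OF MH] has_tangent_const[OF Q]] assms H.one_closed
  by (intro has_tangent_tangent_map) (auto simp: carrier_H)

text \<open>The projection is constant along orbits.\<close>

lemma inf_gen_vertical:
  assumes q: "q \<in> points Q"
  shows "tangent_map Q B \<pi> q (inf_gen H MH Q l \<xi> q) = 0"
proof -
  have one: "\<one>\<^bsub>H\<^esub> \<in> points MH" using H.one_closed carrier_H by simp
  have "has_tangent MH B (\<lambda>g. \<pi> (l g q)) \<one>\<^bsub>H\<^esub> (\<lambda>\<xi>. tangent_map Q B \<pi> q (inf_gen H MH Q l \<xi> q))"
    by (rule has_tangent_compose[OF MH Q has_tangent_orbit_map[OF q]])
      (use has_tangent_orbit q in simp)
  moreover have "has_tangent MH B (\<lambda>g. \<pi> (l g q)) \<one>\<^bsub>H\<^esub> (\<lambda>\<xi>. 0)"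
    by (rule has_tangent_cong[OF MH has_tangent_const[OF B one orbit_points[OF q]]])
      (use eventually_nbhds_points[OF MH one] in eventually_elim, use q in \<open>simp add: carrier_H\<close>)
  ultimately have "(\<lambda>\<xi>. tangent_map Q B \<pi> q (inf_gen H MH Q l \<xi> q)) = (\<lambda>\<xi>. 0)"
    by (rule has_tangent_unique)
  from fun_cong[OF this] show ?thesis .
qed

lemmas has_tangent_Ad = lie_group_has_tangent_Ad[OF H]

text \<open>Differentiate \<open>g (g\<^sup>-\<^sup>1 h g) q = h (g q)\<close> in \<open>h\<close> at the identity.\<close>

lemma inf_gen_equivariant:
  assumes g: "g \<in> carrier H" and q: "q \<in> points Q"
  shows "tangent_map Q Q (l g) q (inf_gen H MH Q l (Ad H MH (inv\<^bsub>H\<^esub> g) \<xi>) q) =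
    inf_gen H MH Q l \<xi> (l g q)"
proof -
  let ?c = "\<lambda>h. inv\<^bsub>H\<^esub> g \<otimes>\<^bsub>H\<^esub> h \<otimes>\<^bsub>H\<^esub> inv\<^bsub>H\<^esub> (inv\<^bsub>H\<^esub> g)"
  have one: "\<one>\<^bsub>H\<^esub> \<in> points MH" using H.one_closed carrier_H by simp
  have c: "has_tangent MH MH ?c \<one>\<^bsub>H\<^esub> (Ad H MH (inv\<^bsub>H\<^esub> g))"
    using has_tangent_Ad[of "inv\<^bsub>H\<^esub> g"] g by simp
  have c1: "?c \<one>\<^bsub>H\<^esub> = \<one>\<^bsub>H\<^esub>" using g by simp
  have 1: "has_tangent MH Q (\<lambda>h. l (?c h) q) \<one>\<^bsub>H\<^esub>
      (\<lambda>\<xi>. inf_gen H MH Q l (Ad H MH (inv\<^bsub>H\<^esub> g) \<xi>) q)"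
    by (rule has_tangent_compose[OF MH MH c]) (use has_tangent_orbit_map[OF q] c1 in simp)
  have "has_tangent MH Q (\<lambda>h. l g (l (?c h) q)) \<one>\<^bsub>H\<^esub>
      (\<lambda>\<xi>. tangent_map Q Q (l g) q (inf_gen H MH Q l (Ad H MH (inv\<^bsub>H\<^esub> g) \<xi>) q))"
    by (rule has_tangent_compose[OF MH Q 1]) (use has_tangent_translation[OF g q] c1 q in simp)
  moreover have "l g (l (?c h) q) = l h (l g q)" if "h \<in> carrier H" for h
    using that g q by (simp add: act_mult)
  ultimately have "has_tangent MH Q (\<lambda>h. l h (l g q)) \<one>\<^bsub>H\<^esub>
      (\<lambda>\<xi>. tangent_map Q Q (l g) q (inf_gen H MH Q l (Ad H MH (inv\<^bsub>H\<^esub> g) \<xi>) q))"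
    using eventually_nbhds_points[OF MH one] unfolding carrier_H[symmetric]
    by (elim has_tangent_cong[OF MH]) (auto elim: eventually_mono)
  from fun_cong[OF has_tangent_unique[OF this has_tangent_orbit_map[OF act_closed[OF g q]]]]
  show ?thesis .
qed

lemma tangent_L_split:
  assumes "q0 \<in> points Q" "q1 \<in> points Q"
  shows "tangent_map (Q \<times>\<^sub>M Q) vs_manifold L (q0, q1) (u, v) = D1 Q L (q0, q1) u + D2 Q L (q0, q1) v"
  unfolding D1_eq[OF Q Q has_tangent_L[OF assms]] D2_eq[OF Q Q has_tangent_L[OF assms]]
  by (rule linear_split[OF has_tangent_linear[OF has_tangent_L[OF assms]]])

lemma tangent_L_invariant:
  assumes g: "g \<in> carrier H" and q: "q0 \<in> points Q" "q1 \<in> points Q"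
  shows "tangent_map (Q \<times>\<^sub>M Q) vs_manifold L (l g q0, l g q1)
           (tangent_map Q Q (l g) q0 u, tangent_map Q Q (l g) q1 v) =
         tangent_map (Q \<times>\<^sub>M Q) vs_manifold L (q0, q1) (u, v)"
proof -
  let ?TL = "tangent_map (Q \<times>\<^sub>M Q) vs_manifold L"
  have pq: "(q0, q1) \<in> points (Q \<times>\<^sub>M Q)" using q by simp
  have "has_tangent (Q \<times>\<^sub>M Q) Q (\<lambda>z. l g (fst z)) (q0, q1) (\<lambda>z. tangent_map Q Q (l g) q0 (fst z))"
    using has_tangent_compose[OF charted_prod[OF Q Q] Q has_tangent_fst[OF Q Q q]]
      has_tangent_translation[OF g q(1)] by simp
  moreover have "has_tangent (Q \<times>\<^sub>M Q) Q (\<lambda>z. l g (snd z)) (q0, q1) (\<lambda>z. tangent_map Q Q (l g) q1 (snd z))"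
    using has_tangent_compose[OF charted_prod[OF Q Q] Q has_tangent_snd[OF Q Q q]]
      has_tangent_translation[OF g q(2)] by simp
  ultimately have "has_tangent (Q \<times>\<^sub>M Q) vs_manifold (\<lambda>z. L (l g (fst z), l g (snd z))) (q0, q1)
      (\<lambda>z. ?TL (l g q0, l g q1) (tangent_map Q Q (l g) q0 (fst z), tangent_map Q Q (l g) q1 (snd z)))"
    using has_tangent_L[of "l g q0" "l g q1"] g q
    by (intro has_tangent_compose2[OF charted_prod[OF Q Q] Q Q]) auto
  then have "has_tangent (Q \<times>\<^sub>M Q) vs_manifold L (q0, q1)
      (\<lambda>z. ?TL (l g q0, l g q1) (tangent_map Q Q (l g) q0 (fst z), tangent_map Q Q (l g) q1 (snd z)))"
  proof (rule has_tangent_cong[OF charted_prod[OF Q Q]])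
    show "\<forall>\<^sub>F z in nbhds (Q \<times>\<^sub>M Q) (q0, q1). L (l g (fst z), l g (snd z)) = L z"
      using eventually_nbhds_points[OF charted_prod[OF Q Q] pq]
      by eventually_elim (use L_invariant[OF g] in auto)
  qed
  from fun_cong[OF has_tangentD[OF this], of "(u, v)"] show ?thesis by simp
qed

lemma J_apply: "J (q0, q1) \<xi> = - D1 Q L (q0, q1) (inf_gen H MH Q l \<xi> q0)"
  unfolding J_def momentum_map_def by simp

lemma translation_tangent_zero: "q \<in> points Q \<Longrightarrow> g \<in> carrier H \<Longrightarrow> tangent_map Q Q (l g) q 0 = 0"
  using has_tangent_linear[OF has_tangent_translation] linear_0 by blast

text \<open>
  The momentum map inherits equivariance from the invariance of \<open>dL\<close> and the equivariance of
  infinitesimal generators.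
\<close>

lemma J_equivariant:
  assumes g: "g \<in> carrier H" and q: "q0 \<in> points Q" "q1 \<in> points Q"
  shows "J (l g q0, l g q1) \<xi> = J (q0, q1) (Ad H MH (inv\<^bsub>H\<^esub> g) \<xi>)"
proof -
  have zero: "D2 Q L (x, y) 0 = 0" if "x \<in> points Q" "y \<in> points Q" for x y
    unfolding D2_eq[OF Q Q has_tangent_L[OF that]]
    using linear_0[OF has_tangent_linear[OF has_tangent_L[OF that]]] by (simp add: zero_prod_def)
  show ?thesis
    using tangent_L_invariant[OF g q, of "inf_gen H MH Q l (Ad H MH (inv\<^bsub>H\<^esub> g) \<xi>) q0" 0] g q zero
    by (simp add: J_apply inf_gen_equivariant translation_tangent_zero tangent_L_split)
qed

text \<open>The invariance of \<open>\<nu>\<close> under \<open>Ad\<close> makes the level set of \<open>J\<close> stable under the diagonal action.\<close>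

lemma J_eq_act:
  assumes "g \<in> carrier H" "q0 \<in> points Q" "q1 \<in> points Q" "J (q0, q1) = \<nu>"
  shows "J (l g q0, l g q1) = \<nu>"
  using J_equivariant[OF assms(1-3)] assms(1,4) \<nu>_Ad by auto

text \<open>
  The two expressions for the momentum agree because \<open>L\<close> is constant along the diagonal orbit
  \<open>g \<mapsto> (g q\<^sub>0, g q\<^sub>1)\<close>.
\<close>

lemma J_eq_D2:
  assumes q: "q0 \<in> points Q" "q1 \<in> points Q"
  shows "D2 Q L (q0, q1) (inf_gen H MH Q l \<xi> q1) = J (q0, q1) \<xi>"
proof -
  have one: "\<one>\<^bsub>H\<^esub> \<in> points MH" using H.one_closed carrier_H by simp
  have "has_tangent MH vs_manifold (\<lambda>g. L (l g q0, l g q1)) \<one>\<^bsub>H\<^esub>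
     (\<lambda>\<xi>. tangent_map (Q \<times>\<^sub>M Q) vs_manifold L (q0, q1)
        (inf_gen H MH Q l \<xi> q0, inf_gen H MH Q l \<xi> q1))"
    by (rule has_tangent_compose2[OF MH Q Q has_tangent_orbit_map has_tangent_orbit_map])
      (use has_tangent_L q in auto)
  moreover have "has_tangent MH vs_manifold (\<lambda>g. L (l g q0, l g q1)) \<one>\<^bsub>H\<^esub> (\<lambda>\<xi>. 0)"
    by (rule has_tangent_cong[OF MH has_tangent_const[OF charted_vs one, of "L (q0, q1)"]])
      (simp, use eventually_nbhds_points[OF MH one] in eventually_elim,
       use q L_invariant in \<open>simp add: carrier_H\<close>)
  ultimately have "(\<lambda>\<xi>. tangent_map (Q \<times>\<^sub>M Q) vs_manifold L (q0, q1)
        (inf_gen H MH Q l \<xi> q0, inf_gen H MH Q l \<xi> q1)) = (\<lambda>\<xi>. 0)"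
    by (rule has_tangent_unique)
  from fun_cong[OF this, of \<xi>] show ?thesis by (simp add: tangent_L_split q J_apply)
qed

lemma A_spec:
  assumes "q0 \<in> points Q" "q1 \<in> points Q"
  shows "A (q0, q1) \<in> carrier H" "J (q0, l (inv\<^bsub>H\<^esub> (A (q0, q1))) q1) = \<nu>"
  using theI'[OF A_ex1[OF assms]] unfolding A_def affine_connection_def by auto

lemma A_one:
  assumes "q0 \<in> points Q" "q1 \<in> points Q" "J (q0, q1) = \<nu>"
  shows "A (q0, q1) = \<one>\<^bsub>H\<^esub>"
  using the1_equality[OF A_ex1[OF assms(1,2)], of "\<one>\<^bsub>H\<^esub>"] assms
  unfolding A_def affine_connection_def by simp

text \<open>
  The discrete lift is well defined: two points of one orbit with the same momentum \<open>\<nu>\<close> give two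
  candidates for \<open>A(q\<^sub>0, q\<^sub>1)\<close>, and there is only one.
\<close>

lemma discrete_lift_eq:
  assumes q: "q0 \<in> points Q" "q1 \<in> points Q" and J: "J (q0, q1) = \<nu>"
  shows "hdisc q0 (\<pi> q1) = q1"
  unfolding discrete_lift_def
proof (rule the_equality)
  fix x assume x: "x \<in> points Q \<and> \<pi> x = \<pi> q1 \<and> J (q0, x) = \<nu>"
  then obtain g where g: "g \<in> carrier H" "x = l g q1" using orbit_eqD[of q1 x] q by metis
  have "inv\<^bsub>H\<^esub> g = \<one>\<^bsub>H\<^esub>"
    using A_ex1[OF q] g x q J by (metis H.inv_closed H.inv_inv H.inv_one H.one_closed act_one)
  then show "x = q1" using g q by (metis H.inv_inv H.inv_one act_one)
qed (use q J in auto)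

lemma fibre_point:
  assumes "q \<in> points Q"
  obtains g where "g \<in> carrier H" "fibre_point Q \<pi> (\<pi> q) = l g q"
proof -
  have "fibre_point Q \<pi> (\<pi> q) \<in> points Q \<and> \<pi> (fibre_point Q \<pi> (\<pi> q)) = \<pi> q"
    unfolding fibre_point_def by (rule someI[of _ q]) (use assms in simp)
  then show ?thesis using orbit_eqD[OF assms] that by metis
qed

text \<open>
  The value at an arbitrary point \<open>q\<^sub>0\<close> of the fibre replaces the value at the chosen one: the two
  differ by the action of some \<open>g\<close>, under which \<open>L\<close> is invariant and the level set of \<open>J\<close> is stable.
\<close>

lemma Lr_eq:
  assumes q: "q0 \<in> points Q" "q1 \<in> points Q"
  shows "Lr (\<pi> q0, \<pi> q1) = L (q0, l (inv\<^bsub>H\<^esub> (A (q0, q1))) q1)"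
proof -
  obtain g where g: "g \<in> carrier H" "fibre_point Q \<pi> (\<pi> q0) = l g q0"
    using fibre_point[OF q(1)] by blast
  let ?x = "l (inv\<^bsub>H\<^esub> (A (q0, q1))) q1"
  have x: "?x \<in> points Q" "\<pi> ?x = \<pi> q1" using A_spec[OF q] q by auto
  have "hdisc (l g q0) (\<pi> (l g ?x)) = l g ?x"
    by (rule discrete_lift_eq) (use J_eq_act[OF g(1) q(1) x(1)] A_spec[OF q] g q x in auto)
  then show ?thesis
    unfolding reduced_lagrangian_def check_lagrangian_def using g q x L_invariant by simp
qed

text \<open>
  A local trivialisation, rewritten as a section \<open>\<sigma>\<close> through \<open>q\<close> together with the group component \<open>\<gamma>\<close>
  relative to \<open>\<sigma>\<close>: near \<open>q\<close>, every point is \<open>\<gamma>(x)\<close> applied to the section over \<open>x\<close>.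
\<close>

lemma local_section:
  assumes q: "q \<in> points Q"
  obtains \<sigma> \<gamma> S \<Gamma> where
    "has_tangent B Q \<sigma> (\<pi> q) S" "has_tangent Q MH \<gamma> q \<Gamma>" "\<sigma> (\<pi> q) = q" "\<gamma> q = \<one>\<^bsub>H\<^esub>"
    "\<forall>\<^sub>F x in nbhds Q q. \<gamma> x \<in> carrier H \<and> l (\<gamma> x) (\<sigma> (\<pi> x)) = x"
    "\<forall>\<^sub>F u in nbhds B (\<pi> q). \<sigma> u \<in> points Q \<and> \<pi> (\<sigma> u) = u"
proof -
  have b: "\<pi> q \<in> points B" by (rule orbit_points[OF q])
  have "\<forall>b\<in>points B. \<exists>U \<Phi>. b \<in> U \<and> openin (mtop B) U \<and>
      diffeo_on (B \<times>\<^sub>M MH) Q (U \<times> carrier H) {x \<in> points Q. \<pi> x \<in> U} \<Phi> \<and>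
      (\<forall>u\<in>U. \<forall>g\<in>carrier H. \<pi> (\<Phi> (u, g)) = u) \<and>
      (\<forall>u\<in>U. \<forall>g\<in>carrier H. \<forall>h\<in>carrier H. \<Phi> (u, g \<otimes>\<^bsub>H\<^esub> h) = l g (\<Phi> (u, h)))"
    using quotient unfolding quotient_principal_bundle_def by (elim conjE)
  from bspec[OF this b] obtain U \<Phi> where bU: "\<pi> q \<in> U" and U: "openin (mtop B) U"
    and diffeo: "diffeo_on (B \<times>\<^sub>M MH) Q (U \<times> carrier H) {x \<in> points Q. \<pi> x \<in> U} \<Phi>"
    and proj: "\<And>u g. u \<in> U \<Longrightarrow> g \<in> carrier H \<Longrightarrow> \<pi> (\<Phi> (u, g)) = u"
    and equiv: "\<And>u g h. u \<in> U \<Longrightarrow> g \<in> carrier H \<Longrightarrow> h \<in> carrier H \<Longrightarrow> \<Phi> (u, g \<otimes>\<^bsub>H\<^esub> h) = l g (\<Phi> (u, h))"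
    by (elim exE conjE) simp
  let ?W = "U \<times> carrier H" and ?V = "{x \<in> points Q. \<pi> x \<in> U}"
  define \<Psi> where "\<Psi> = inv_into ?W \<Phi>"
  have bij: "bij_betw \<Phi> ?W ?V" and sm\<Phi>: "smooth_map_on (B \<times>\<^sub>M MH) Q ?W \<Phi>"
    and sm\<Psi>: "smooth_map_on Q (B \<times>\<^sub>M MH) ?V \<Psi>"
    using diffeo unfolding diffeo_on_def \<Psi>_def by auto
  have \<Psi>: "\<Psi> x \<in> ?W" "\<Phi> (\<Psi> x) = x" if "x \<in> ?V" for x
  proof -
    have "x \<in> \<Phi> ` ?W" using bij_betw_imp_surj_on[OF bij] that by simp
    then show "\<Psi> x \<in> ?W" "\<Phi> (\<Psi> x) = x"
      unfolding \<Psi>_def by (rule inv_into_into, rule f_inv_into_f)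
  qed
  have fst\<Psi>: "fst (\<Psi> x) = \<pi> x" if "x \<in> ?V" for x
    using \<Psi>[OF that] proj[of "fst (\<Psi> x)" "snd (\<Psi> x)"] by auto
  have qV: "q \<in> ?V" using q bU by simp
  define g0 where "g0 = snd (\<Psi> q)"
  have g0: "g0 \<in> carrier H" and \<Psi>q: "\<Psi> q = (\<pi> q, g0)"
    using \<Psi>[OF qV] fst\<Psi>[OF qV] unfolding g0_def by (auto simp: mem_Times_iff prod_eq_iff)
  have \<Psi>_tangent: "has_tangent Q (B \<times>\<^sub>M MH) \<Psi> q (tangent_map Q (B \<times>\<^sub>M MH) \<Psi> q)"
    by (rule has_tangent_smooth_on[OF Q charted_prod[OF B MH] sm\<Psi> qV])
  have \<Phi>_tangent: "has_tangent (B \<times>\<^sub>M MH) Q \<Phi> (\<pi> q, g0) (tangent_map (B \<times>\<^sub>M MH) Q \<Phi> (\<pi> q, g0))"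
    by (rule has_tangent_smooth_on[OF charted_prod[OF B MH] Q sm\<Phi>]) (use bU g0 in simp)
  define \<sigma> where "\<sigma> u = \<Phi> (u, g0)" for u
  define \<gamma> where "\<gamma> x = snd (\<Psi> x) \<otimes>\<^bsub>H\<^esub> inv\<^bsub>H\<^esub> g0" for x
  have \<sigma>: "has_tangent B Q \<sigma> (\<pi> q) (\<lambda>w. tangent_map (B \<times>\<^sub>M MH) Q \<Phi> (\<pi> q, g0) (w, 0))"
    unfolding \<sigma>_def by (rule has_tangent_partial1[OF B MH \<Phi>_tangent])
  have "has_tangent Q MH (\<lambda>x. snd (\<Psi> x)) q (\<lambda>v. snd (tangent_map Q (B \<times>\<^sub>M MH) \<Psi> q v))"
    by (rule has_tangent_compose[OF Q charted_prod[OF B MH] \<Psi>_tangent])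
      (use has_tangent_snd[OF B MH b] g0 \<Psi>q in \<open>simp add: carrier_H\<close>)
  from has_tangent_mult[OF Q this has_tangent_const[OF MH q, of "inv\<^bsub>H\<^esub> g0"]] g0
  obtain \<Gamma> where \<gamma>: "has_tangent Q MH \<gamma> q \<Gamma>"
    unfolding \<gamma>_def by (auto simp: carrier_H[symmetric])
  have open_V: "openin (mtop Q) ?V" using sm\<Psi> unfolding smooth_map_on_def by blast
  show ?thesis
  proof (rule that[OF \<sigma> \<gamma>])
    show "\<sigma> (\<pi> q) = q" unfolding \<sigma>_def using \<Psi>(2)[OF qV] \<Psi>q by simp
    show "\<gamma> q = \<one>\<^bsub>H\<^esub>" unfolding \<gamma>_def using \<Psi>q g0 by simp
    have "\<gamma> x \<in> carrier H \<and> l (\<gamma> x) (\<sigma> (\<pi> x)) = x" if x: "x \<in> ?V" for x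
    proof -
      have s: "snd (\<Psi> x) \<in> carrier H" using \<Psi>(1)[OF x] by auto
      then have \<gamma>x: "\<gamma> x \<in> carrier H" unfolding \<gamma>_def using g0 by simp
      have "l (\<gamma> x) (\<sigma> (\<pi> x)) = \<Phi> (\<pi> x, \<gamma> x \<otimes>\<^bsub>H\<^esub> g0)"
        unfolding \<sigma>_def using equiv[of "\<pi> x" "\<gamma> x" g0] x \<gamma>x g0 by simp
      also have "\<gamma> x \<otimes>\<^bsub>H\<^esub> g0 = snd (\<Psi> x)"
        unfolding \<gamma>_def using s g0 by (simp add: H.m_assoc)
      also have "(\<pi> x, snd (\<Psi> x)) = \<Psi> x" using fst\<Psi>[OF x] by (simp add: prod_eq_iff)
      finally show ?thesis using \<Psi>(2)[OF x] \<gamma>x by simp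
    qed
    then show "\<forall>\<^sub>F x in nbhds Q q. \<gamma> x \<in> carrier H \<and> l (\<gamma> x) (\<sigma> (\<pi> x)) = x"
      using eventually_nbhds_open[OF Q open_V qV] by (auto elim: eventually_mono)
    have "\<sigma> u \<in> points Q \<and> \<pi> (\<sigma> u) = u" if "u \<in> U" for u
      using proj[OF that g0] bij_betwE[OF bij] that g0 unfolding \<sigma>_def by blast
    then show "\<forall>\<^sub>F u in nbhds B (\<pi> q). \<sigma> u \<in> points Q \<and> \<pi> (\<sigma> u) = u"
      using eventually_nbhds_open[OF B U bU] by (auto elim: eventually_mono)
  qed
qed

text \<open>
  The linearisation of \<open>x = \<gamma>(x) \<sigma>(\<pi>(x))\<close>.  It shows at once that \<open>T\<pi>\<close> is onto and that its kernel
  consists of the vertical vectors.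
\<close>

lemma tangent_decomposition:
  assumes q: "q \<in> points Q"
  obtains S \<Gamma> where "linear S" "linear \<Gamma>"
    "\<forall>v. v = inf_gen H MH Q l (\<Gamma> v) q + S (tangent_map Q B \<pi> q v)"
    "\<forall>w. tangent_map Q B \<pi> q (S w) = w"
proof -
  obtain \<sigma> \<gamma> S \<Gamma> where S: "has_tangent B Q \<sigma> (\<pi> q) S" and \<Gamma>: "has_tangent Q MH \<gamma> q \<Gamma>"
    and base: "\<sigma> (\<pi> q) = q" "\<gamma> q = \<one>\<^bsub>H\<^esub>"
    and near: "\<forall>\<^sub>F x in nbhds Q q. \<gamma> x \<in> carrier H \<and> l (\<gamma> x) (\<sigma> (\<pi> x)) = x"
    and sec: "\<forall>\<^sub>F u in nbhds B (\<pi> q). \<sigma> u \<in> points Q \<and> \<pi> (\<sigma> u) = u"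
    by (rule local_section[OF q])
  let ?T = "tangent_map Q B \<pi> q" and ?\<Lambda> = "tangent_map (MH \<times>\<^sub>M Q) Q (\<lambda>(g, q). l g q) (\<one>\<^bsub>H\<^esub>, q)"
  have one: "\<one>\<^bsub>H\<^esub> \<in> points MH" using H.one_closed carrier_H by simp
  have \<Lambda>: "has_tangent (MH \<times>\<^sub>M Q) Q (\<lambda>(g, q). l g q) (\<one>\<^bsub>H\<^esub>, q) ?\<Lambda>"
    using act_tangent[OF H.one_closed q] has_tangent_tangent_map by (elim exE)
  have \<Lambda>1: "?\<Lambda> (\<xi>, 0) = inf_gen H MH Q l \<xi> q" for \<xi>
    using has_tangent_unique[OF has_tangent_partial1[OF MH Q \<Lambda>]] has_tangent_orbit_map[OF q]
    by (simp add: fun_eq_iff)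
  have "has_tangent Q Q (\<lambda>x. l \<one>\<^bsub>H\<^esub> x) q (\<lambda>v. ?\<Lambda> (0, v))"
    using has_tangent_partial2[OF MH Q \<Lambda>] by simp
  then have "has_tangent Q Q (\<lambda>x. x) q (\<lambda>v. ?\<Lambda> (0, v))"
    by (rule has_tangent_cong[OF Q])
      (use eventually_nbhds_points[OF Q q] in eventually_elim, simp)
  from has_tangent_unique[OF this has_tangent_id[OF Q q]]
  have \<Lambda>2: "?\<Lambda> (0, v) = v" for v by (simp add: fun_eq_iff)
  have "has_tangent Q Q (\<lambda>x. \<sigma> (\<pi> x)) q (\<lambda>v. S (?T v))"
    by (rule has_tangent_compose[OF Q B has_tangent_orbit[OF q] S])
  from has_tangent_act[OF Q \<Gamma> this] base
  have "has_tangent Q Q (\<lambda>x. l (\<gamma> x) (\<sigma> (\<pi> x))) q (\<lambda>v. ?\<Lambda> (\<Gamma> v, S (?T v)))" by simp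
  then have "has_tangent Q Q (\<lambda>x. x) q (\<lambda>v. ?\<Lambda> (\<Gamma> v, S (?T v)))"
    by (rule has_tangent_cong[OF Q]) (use near in eventually_elim, simp)
  from has_tangent_unique[OF this has_tangent_id[OF Q q]]
  have "?\<Lambda> (\<Gamma> v, S (?T v)) = v" for v by (simp add: fun_eq_iff)
  then have split: "v = inf_gen H MH Q l (\<Gamma> v) q + S (?T v)" for v
    using linear_split[OF has_tangent_linear[OF \<Lambda>], of "\<Gamma> v" "S (?T v)"] \<Lambda>1 \<Lambda>2 by simp
  have "has_tangent B B (\<lambda>u. \<pi> (\<sigma> u)) (\<pi> q) (\<lambda>w. ?T (S w))"
    by (rule has_tangent_compose[OF B Q S]) (use has_tangent_orbit[OF q] base in simp)
  then have "has_tangent B B (\<lambda>u. u) (\<pi> q) (\<lambda>w. ?T (S w))"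
    by (rule has_tangent_cong[OF B]) (use sec in eventually_elim, simp)
  from has_tangent_unique[OF this has_tangent_id[OF B orbit_points[OF q]]]
  have "?T (S w) = w" for w by (simp add: fun_eq_iff)
  with split show ?thesis
    by (intro that[OF has_tangent_linear[OF S] has_tangent_linear[OF \<Gamma>]]) blast+
qed

lemma linear_inf_gen: "q \<in> points Q \<Longrightarrow> linear (\<lambda>\<xi>. inf_gen H MH Q l \<xi> q)"
  by (rule has_tangent_linear[OF has_tangent_orbit_map])

lemma linear_orbit: "q \<in> points Q \<Longrightarrow> linear (tangent_map Q B \<pi> q)"
  by (rule has_tangent_linear[OF has_tangent_orbit])

lemma connection_facts:
  shows linear_connection: "q \<in> points Q \<Longrightarrow> linear (\<AA> q)"
    and connection_inf_gen: "q \<in> points Q \<Longrightarrow> \<AA> q (inf_gen H MH Q l \<xi> q) = \<xi>"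
    and connection_equivariant: "g \<in> carrier H \<Longrightarrow> q \<in> points Q \<Longrightarrow>
      \<AA> (l g q) (tangent_map Q Q (l g) q v) = Ad H MH g (\<AA> q v)"
  using connection unfolding principal_connection_def by blast+

text \<open>
  Horizontal lifts are unique: a horizontal vector in the kernel of \<open>T\<pi>\<close> is an infinitesimal generator
  \<open>\<xi>\<^sub>Q(q)\<close>, and the connection returns \<open>\<xi>\<close>, which is therefore \<open>0\<close>.
\<close>

lemma hlift_eq:
  assumes q: "q \<in> points Q" and v: "\<AA> q v = 0" "tangent_map Q B \<pi> q v = w"
  shows "hlift q w = v"
  unfolding horizontal_lift_def
proof (rule the_equality)
  fix v' assume v': "\<AA> q v' = 0 \<and> tangent_map Q B \<pi> q v' = w"
  obtain S \<Gamma> where S: "linear S" "linear \<Gamma>"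
    and split: "\<forall>v. v = inf_gen H MH Q l (\<Gamma> v) q + S (tangent_map Q B \<pi> q v)"
    and "\<forall>w. tangent_map Q B \<pi> q (S w) = w"
    by (rule tangent_decomposition[OF q])
  have "\<AA> q (v' - v) = 0" "tangent_map Q B \<pi> q (v' - v) = 0"
    using v v' linear_diff[OF linear_connection[OF q]] linear_diff[OF linear_orbit[OF q]] by auto
  then have vert: "v' - v = inf_gen H MH Q l (\<Gamma> (v' - v)) q"
    using split[rule_format, of "v' - v"] linear_0[OF S(1)] by simp
  then have "\<Gamma> (v' - v) = 0"
    using \<open>\<AA> q (v' - v) = 0\<close> connection_inf_gen[OF q] by metis
  then show "v' = v" using vert linear_0[OF linear_inf_gen[OF q]] by simp
qed (use v in simp)

text \<open>Horizontal lifts exist: lift by a local section and subtract the vertical part.\<close>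

lemma hlift_spec:
  assumes q: "q \<in> points Q"
  shows "\<AA> q (hlift q w) = 0" "tangent_map Q B \<pi> q (hlift q w) = w"
proof -
  obtain S \<Gamma> where "linear S" "linear \<Gamma>"
    and "\<forall>v. v = inf_gen H MH Q l (\<Gamma> v) q + S (tangent_map Q B \<pi> q v)"
    and S: "\<forall>w. tangent_map Q B \<pi> q (S w) = w"
    by (rule tangent_decomposition[OF q])
  let ?v = "S w - inf_gen H MH Q l (\<AA> q (S w)) q"
  have "\<AA> q ?v = 0" "tangent_map Q B \<pi> q ?v = w"
    using linear_diff[OF linear_connection[OF q]] linear_diff[OF linear_orbit[OF q]]
      connection_inf_gen[OF q] inf_gen_vertical[OF q] S by auto
  with hlift_eq[OF q this] show "\<AA> q (hlift q w) = 0" "tangent_map Q B \<pi> q (hlift q w) = w"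
    by auto
qed

lemma hlift_zero: "q \<in> points Q \<Longrightarrow> hlift q 0 = 0"
  by (simp add: hlift_eq linear_0[OF linear_connection] linear_0[OF linear_orbit])

lemma vertical_horizontal_split:
  assumes q: "q \<in> points Q"
  obtains \<xi> w where "v = inf_gen H MH Q l \<xi> q + hlift q w"
proof -
  let ?u = "v - inf_gen H MH Q l (\<AA> q v) q"
  have "\<AA> q ?u = 0"
    using linear_diff[OF linear_connection[OF q]] connection_inf_gen[OF q] by simp
  from that[of "\<AA> q v" "tangent_map Q B \<pi> q ?u"] hlift_eq[OF q this refl] show ?thesis by simp
qed

text \<open>
  Translation by \<open>g\<close> sends horizontal vectors to horizontal ones, by equivariance of the connection, and
  does not change their projection.
\<close>

lemma hlift_act:
  assumes g: "g \<in> carrier H" and q: "q \<in> points Q"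
  shows "hlift (l g q) w = tangent_map Q Q (l g) q (hlift q w)"
proof (rule hlift_eq)
  obtain D where D: "linear D" "\<And>\<xi>. Ad H MH g \<xi> = D \<xi>"
    using has_tangent_linear[OF has_tangent_Ad[OF g]] by blast
  show "\<AA> (l g q) (tangent_map Q Q (l g) q (hlift q w)) = 0"
    using connection_equivariant[OF g q] hlift_spec(1)[OF q] D linear_0[OF D(1)] by simp
  have "has_tangent Q B (\<lambda>x. \<pi> (l g x)) q
      (\<lambda>v. tangent_map Q B \<pi> (l g q) (tangent_map Q Q (l g) q v))"
    by (rule has_tangent_compose[OF Q Q has_tangent_translation[OF g q]])
      (use has_tangent_orbit g q in simp)
  then have "has_tangent Q B \<pi> q (\<lambda>v. tangent_map Q B \<pi> (l g q) (tangent_map Q Q (l g) q v))"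
    by (rule has_tangent_cong[OF Q])
      (use eventually_nbhds_points[OF Q q] in eventually_elim, use g in simp)
  from fun_cong[OF has_tangentD[OF this], of "hlift q w"] hlift_spec(2)[OF q]
  show "tangent_map Q B \<pi> (l g q) (tangent_map Q Q (l g) q (hlift q w)) = w" by simp
qed (use g q in simp)

lemma has_tangent_level_shift:
  assumes "charted M" "has_tangent M Q x p D" "has_tangent M Q y p E"
  shows "\<exists>F. has_tangent M Q (\<lambda>m. l (inv\<^bsub>H\<^esub> (A (x m, y m))) (y m)) p F"
proof -
  have "has_tangent M MH (\<lambda>m. A (x m, y m)) p
      (\<lambda>v. tangent_map (Q \<times>\<^sub>M Q) MH A (x p, y p) (D v, E v))"
    using has_tangent_compose2[OF assms(1) Q Q assms(2,3) has_tangent_A]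
      has_tangent_points[OF assms(2)] has_tangent_points[OF assms(3)] by simp
  from has_tangent_inv[OF assms(1) this]
  obtain K where "has_tangent M MH (\<lambda>m. inv\<^bsub>H\<^esub> (A (x m, y m))) p K" ..
  from has_tangent_act[OF assms(1) this assms(3)] show ?thesis by blast
qed

text \<open>
  The definition of the reduced Lagrangian picks the point over its first argument arbitrarily.  By \<open>Lr_eq\<close>
  any local sections may be used over the two arguments instead, which exhibits the reduced Lagrangian as a composition of
  differentiable maps.
\<close>

lemma has_tangent_Lr:
  assumes q: "q0 \<in> points Q" "q1 \<in> points Q"
  shows "has_tangent (B \<times>\<^sub>M B) vs_manifold Lr (\<pi> q0, \<pi> q1)
           (tangent_map (B \<times>\<^sub>M B) vs_manifold Lr (\<pi> q0, \<pi> q1))"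
proof -
  obtain \<sigma>0 \<gamma>0 S0 \<Gamma>0 where \<sigma>0: "has_tangent B Q \<sigma>0 (\<pi> q0) S0"
    and "has_tangent Q MH \<gamma>0 q0 \<Gamma>0" "\<sigma>0 (\<pi> q0) = q0" "\<gamma>0 q0 = \<one>\<^bsub>H\<^esub>"
      "\<forall>\<^sub>F x in nbhds Q q0. \<gamma>0 x \<in> carrier H \<and> l (\<gamma>0 x) (\<sigma>0 (\<pi> x)) = x"
    and near0: "\<forall>\<^sub>F u in nbhds B (\<pi> q0). \<sigma>0 u \<in> points Q \<and> \<pi> (\<sigma>0 u) = u"
    by (rule local_section[OF q(1)])
  obtain \<sigma>1 \<gamma>1 S1 \<Gamma>1 where \<sigma>1: "has_tangent B Q \<sigma>1 (\<pi> q1) S1"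
    and "has_tangent Q MH \<gamma>1 q1 \<Gamma>1" "\<sigma>1 (\<pi> q1) = q1" "\<gamma>1 q1 = \<one>\<^bsub>H\<^esub>"
      "\<forall>\<^sub>F x in nbhds Q q1. \<gamma>1 x \<in> carrier H \<and> l (\<gamma>1 x) (\<sigma>1 (\<pi> x)) = x"
    and near1: "\<forall>\<^sub>F u in nbhds B (\<pi> q1). \<sigma>1 u \<in> points Q \<and> \<pi> (\<sigma>1 u) = u"
    by (rule local_section[OF q(2)])
  note BB = charted_prod[OF B B]
  note b = orbit_points[OF q(1)] orbit_points[OF q(2)]
  have t0: "has_tangent (B \<times>\<^sub>M B) Q (\<lambda>u. \<sigma>0 (fst u)) (\<pi> q0, \<pi> q1) (\<lambda>w. S0 (fst w))"
    by (rule has_tangent_compose[OF BB B has_tangent_fst[OF B B b]]) (use \<sigma>0 in simp)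
  have t1: "has_tangent (B \<times>\<^sub>M B) Q (\<lambda>u. \<sigma>1 (snd u)) (\<pi> q0, \<pi> q1) (\<lambda>w. S1 (snd w))"
    by (rule has_tangent_compose[OF BB B has_tangent_snd[OF B B b]]) (use \<sigma>1 in simp)
  obtain K where K: "has_tangent (B \<times>\<^sub>M B) Q
      (\<lambda>u. l (inv\<^bsub>H\<^esub> (A (\<sigma>0 (fst u), \<sigma>1 (snd u)))) (\<sigma>1 (snd u))) (\<pi> q0, \<pi> q1) K"
    using has_tangent_level_shift[OF BB t0 t1] by (elim exE)
  have ev: "\<forall>\<^sub>F u in nbhds (B \<times>\<^sub>M B) (\<pi> q0, \<pi> q1). \<sigma>0 (fst u) \<in> points Q \<and> \<pi> (\<sigma>0 (fst u)) = fst u \<and>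
      \<sigma>1 (snd u) \<in> points Q \<and> \<pi> (\<sigma>1 (snd u)) = snd u"
    using has_tangent_eventually[OF BB B has_tangent_fst[OF B B b], simplified, OF near0]
      has_tangent_eventually[OF BB B has_tangent_snd[OF B B b], simplified, OF near1]
    by eventually_elim simp
  have "has_tangent (B \<times>\<^sub>M B) vs_manifold
      (\<lambda>u. L (\<sigma>0 (fst u), l (inv\<^bsub>H\<^esub> (A (\<sigma>0 (fst u), \<sigma>1 (snd u)))) (\<sigma>1 (snd u)))) (\<pi> q0, \<pi> q1)
      (\<lambda>w. tangent_map (Q \<times>\<^sub>M Q) vs_manifold L
        (\<sigma>0 (fst (\<pi> q0, \<pi> q1)), l (inv\<^bsub>H\<^esub> (A (\<sigma>0 (fst (\<pi> q0, \<pi> q1)), \<sigma>1 (snd (\<pi> q0, \<pi> q1)))))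
          (\<sigma>1 (snd (\<pi> q0, \<pi> q1)))) (S0 (fst w), K w))"
    by (rule has_tangent_compose2[OF BB Q Q t0 K has_tangent_L])
      (use has_tangent_points[OF t0] has_tangent_points[OF K] in simp_all)
  then have "has_tangent (B \<times>\<^sub>M B) vs_manifold Lr (\<pi> q0, \<pi> q1)
      (\<lambda>w. tangent_map (Q \<times>\<^sub>M Q) vs_manifold L
        (\<sigma>0 (fst (\<pi> q0, \<pi> q1)), l (inv\<^bsub>H\<^esub> (A (\<sigma>0 (fst (\<pi> q0, \<pi> q1)), \<sigma>1 (snd (\<pi> q0, \<pi> q1)))))
          (\<sigma>1 (snd (\<pi> q0, \<pi> q1)))) (S0 (fst w), K w))"
  proof (rule has_tangent_cong[OF BB])
    show "\<forall>\<^sub>F u in nbhds (B \<times>\<^sub>M B) (\<pi> q0, \<pi> q1).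
        L (\<sigma>0 (fst u), l (inv\<^bsub>H\<^esub> (A (\<sigma>0 (fst u), \<sigma>1 (snd u)))) (\<sigma>1 (snd u))) = Lr u"
      using ev
    proof eventually_elim
      case (elim u)
      then show ?case using Lr_eq[of "\<sigma>0 (fst u)" "\<sigma>1 (snd u)"] by simp
    qed
  qed
  then show ?thesis by (rule has_tangent_tangent_map)
qed

text \<open>
  The function \<open>K(w, z) = L(z\<^sub>0, w A(z)\<^sup>-\<^sup>1 z\<^sub>1)\<close> has three restrictions: \<open>K(A z, z)\<close> is \<open>L\<close>,
  \<open>K(\<one>, z)\<close> is the reduced Lagrangian, and \<open>K(w, (q\<^sub>0, q\<^sub>1))\<close> is the function whose derivative in \<open>w\<close> occurs in the
  reduced force.  The identity is the chain rule for the first, split into the partial derivatives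
  given by the other two.
\<close>

lemma tangent_L_reduced:
  assumes q: "q0 \<in> points Q" "q1 \<in> points Q" and J: "J (q0, q1) = \<nu>"
  shows "tangent_map (Q \<times>\<^sub>M Q) vs_manifold L (q0, q1) (v0, v1) =
    tangent_map (B \<times>\<^sub>M B) vs_manifold Lr (\<pi> q0, \<pi> q1)
      (tangent_map Q B \<pi> q0 v0, tangent_map Q B \<pi> q1 v1) +
    differential MH (\<lambda>w. Lc (q0, w, \<pi> q1)) \<one>\<^bsub>H\<^esub> (tangent_map (Q \<times>\<^sub>M Q) MH A (q0, q1) (v0, v1))"
proof -
  define y where "y z = l (inv\<^bsub>H\<^esub> (A z)) (snd z)" for z
  define K where "K = (\<lambda>(w, z). L (fst z, l w (y z)))"
  note QQ = charted_prod[OF Q Q] and MQQ = charted_prod[OF MH charted_prod[OF Q Q]]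
  have pq: "(q0, q1) \<in> points (Q \<times>\<^sub>M Q)" using q by simp
  have one: "\<one>\<^bsub>H\<^esub> \<in> points MH" using H.one_closed carrier_H by simp
  have A1: "A (q0, q1) = \<one>\<^bsub>H\<^esub>" by (rule A_one[OF q J])
  have y1: "y (q0, q1) = q1" unfolding y_def using A1 q by simp
  obtain Y where Y: "has_tangent (Q \<times>\<^sub>M Q) Q y (q0, q1) Y"
    using has_tangent_level_shift[OF QQ has_tangent_fst[OF Q Q q] has_tangent_snd[OF Q Q q]]
    unfolding y_def by auto
  let ?p = "(\<one>\<^bsub>H\<^esub>, q0, q1)"
  have snd: "has_tangent (MH \<times>\<^sub>M Q \<times>\<^sub>M Q) (Q \<times>\<^sub>M Q) snd ?p snd"
    by (rule has_tangent_snd[OF MH QQ one pq])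
  have Ysnd: "has_tangent (MH \<times>\<^sub>M Q \<times>\<^sub>M Q) Q (\<lambda>x. y (snd x)) ?p (\<lambda>v. Y (snd v))"
    by (rule has_tangent_compose[OF MQQ QQ snd]) (use Y in simp)
  have fstsnd: "has_tangent (MH \<times>\<^sub>M Q \<times>\<^sub>M Q) Q (\<lambda>x. fst (snd x)) ?p (\<lambda>v. fst (snd v))"
    by (rule has_tangent_compose[OF MQQ QQ snd]) (use has_tangent_fst[OF Q Q q] in simp)
  obtain E where E: "has_tangent (MH \<times>\<^sub>M Q \<times>\<^sub>M Q) Q (\<lambda>x. l (fst x) (y (snd x))) ?p E"
    using has_tangent_act[OF MQQ has_tangent_fst[OF MH QQ one pq] Ysnd] by blast
  have "has_tangent (MH \<times>\<^sub>M Q \<times>\<^sub>M Q) vs_manifold K ?p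
      (\<lambda>v. tangent_map (Q \<times>\<^sub>M Q) vs_manifold L (q0, q1) (fst (snd v), E v))"
    unfolding K_def case_prod_beta
    by (rule has_tangent_compose2[OF MQQ Q Q fstsnd E]) (use has_tangent_L[OF q] y1 q in simp)
  then obtain K' where K': "has_tangent (MH \<times>\<^sub>M Q \<times>\<^sub>M Q) vs_manifold K ?p K'" by blast
  note A' = has_tangent_A[OF q]
  \<comment> \<open>The group element \<open>A z\<close> undoes the shift by \<open>A(z)\<^sup>-\<^sup>1\<close>, so \<open>K(A z, z) = L z\<close>.\<close>
  have "has_tangent (Q \<times>\<^sub>M Q) vs_manifold (\<lambda>z. K (A z, z)) (q0, q1)
      (\<lambda>v. K' (tangent_map (Q \<times>\<^sub>M Q) MH A (q0, q1) v, v))"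
    by (rule has_tangent_compose2[OF QQ MH QQ A' has_tangent_id[OF QQ pq]]) (use K' A1 in simp)
  then have "has_tangent (Q \<times>\<^sub>M Q) vs_manifold L (q0, q1)
      (\<lambda>v. K' (tangent_map (Q \<times>\<^sub>M Q) MH A (q0, q1) v, v))"
    by (rule has_tangent_cong[OF QQ])
      (use eventually_nbhds_points[OF QQ pq] in eventually_elim,
       use A_spec in \<open>auto simp: K_def y_def\<close>)
  from fun_cong[OF has_tangentD[OF this], of "(v0, v1)"]
  have "tangent_map (Q \<times>\<^sub>M Q) vs_manifold L (q0, q1) (v0, v1) =
      K' (0, (v0, v1)) + K' (tangent_map (Q \<times>\<^sub>M Q) MH A (q0, q1) (v0, v1), 0)"
    using linear_split[OF has_tangent_linear[OF K'],
        of "tangent_map (Q \<times>\<^sub>M Q) MH A (q0, q1) (v0, v1)" "(v0, v1)"] by simp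
  \<comment> \<open>Without any shift by \<open>w\<close>, \<open>K\<close> is the pullback of the reduced Lagrangian.\<close>
  moreover have "K' (0, (v0, v1)) = tangent_map (B \<times>\<^sub>M B) vs_manifold Lr (\<pi> q0, \<pi> q1)
      (tangent_map Q B \<pi> q0 v0, tangent_map Q B \<pi> q1 v1)"
  proof -
    have t0: "has_tangent (Q \<times>\<^sub>M Q) B (\<lambda>z. \<pi> (fst z)) (q0, q1) (\<lambda>v. tangent_map Q B \<pi> q0 (fst v))"
      by (rule has_tangent_compose[OF QQ Q has_tangent_fst[OF Q Q q]])
        (use has_tangent_orbit[OF q(1)] in simp)
    have t1: "has_tangent (Q \<times>\<^sub>M Q) B (\<lambda>z. \<pi> (snd z)) (q0, q1) (\<lambda>v. tangent_map Q B \<pi> q1 (snd v))"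
      by (rule has_tangent_compose[OF QQ Q has_tangent_snd[OF Q Q q]])
        (use has_tangent_orbit[OF q(2)] in simp)
    have "has_tangent (Q \<times>\<^sub>M Q) vs_manifold (\<lambda>z. Lr (\<pi> (fst z), \<pi> (snd z))) (q0, q1)
        (\<lambda>v. tangent_map (B \<times>\<^sub>M B) vs_manifold Lr (\<pi> q0, \<pi> q1)
          (tangent_map Q B \<pi> q0 (fst v), tangent_map Q B \<pi> q1 (snd v)))"
      by (rule has_tangent_compose2[OF QQ B B t0 t1]) (use has_tangent_Lr[OF q] in simp)
    moreover have "has_tangent (Q \<times>\<^sub>M Q) vs_manifold (\<lambda>z. Lr (\<pi> (fst z), \<pi> (snd z))) (q0, q1)
        (\<lambda>v. K' (0, v))"
      by (rule has_tangent_cong[OF QQ has_tangent_partial2[OF MH QQ K']])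
        (use eventually_nbhds_points[OF QQ pq] in eventually_elim,
         use A_spec(1) in \<open>auto simp: K_def y_def Lr_eq\<close>)
    ultimately have "(\<lambda>v. K' (0, v)) = (\<lambda>v. tangent_map (B \<times>\<^sub>M B) vs_manifold Lr (\<pi> q0, \<pi> q1)
          (tangent_map Q B \<pi> q0 (fst v), tangent_map Q B \<pi> q1 (snd v)))"
      by (rule has_tangent_unique[rotated])
    from fun_cong[OF this, of "(v0, v1)"] show ?thesis by simp
  qed
  moreover have "K' (\<eta>, 0) = differential MH (\<lambda>w. Lc (q0, w, \<pi> q1)) \<one>\<^bsub>H\<^esub> \<eta>" for \<eta>
  proof -
    have "(\<lambda>w. K (w, q0, q1)) = (\<lambda>w. Lc (q0, w, \<pi> q1))"
      by (simp add: K_def y1 check_lagrangian_def discrete_lift_eq[OF q J])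
    with has_tangentD[OF has_tangent_partial1[OF MH QQ K']] show ?thesis by simp
  qed
  ultimately show ?thesis by simp
qed

lemma tangent_Lr_split:
  assumes "q0 \<in> points Q" "q1 \<in> points Q"
  shows "tangent_map (B \<times>\<^sub>M B) vs_manifold Lr (\<pi> q0, \<pi> q1) (u, v) =
    D1 B Lr (\<pi> q0, \<pi> q1) u + D2 B Lr (\<pi> q0, \<pi> q1) v"
  unfolding D1_eq[OF B B has_tangent_Lr[OF assms]] D2_eq[OF B B has_tangent_Lr[OF assms]]
  by (rule linear_split[OF has_tangent_linear[OF has_tangent_Lr[OF assms]]])

text \<open>
  The force is defined at the chosen point \<open>g q\<^sub>0\<close> of the fibre, and at its discrete lift \<open>g q\<^sub>1\<close>.  After
  \<open>tangent_L_reduced\<close> has been applied there, only \<open>dL\<close> on horizontal lifts still depends on \<open>g\<close>, and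
  that dependence cancels by invariance.  Splitting the result into its two arguments gives the forces \<open>f\<^sup>-\<close> and
  \<open>f\<^sup>+\<close>.
\<close>

lemma force_eq:
  assumes q: "q0 \<in> points Q" "q1 \<in> points Q" and J: "J (q0, q1) = \<nu>"
  shows "f (\<pi> q0, \<pi> q1) (u, v) =
    (D1 Q L (q0, q1) (hlift q0 u) - D1 B Lr (\<pi> q0, \<pi> q1) u) +
    (D2 Q L (q0, q1) (hlift q1 v) - D2 B Lr (\<pi> q0, \<pi> q1) v)"
proof -
  obtain g where g: "g \<in> carrier H" "fibre_point Q \<pi> (\<pi> q0) = l g q0"
    using fibre_point[OF q(1)] by blast
  let ?p0 = "l g q0" and ?p1 = "l g q1"
  have p: "?p0 \<in> points Q" "?p1 \<in> points Q" using g q by auto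
  have Jp: "J (?p0, ?p1) = \<nu>" by (rule J_eq_act[OF g(1) q J])
  have "hdisc ?p0 (\<pi> q1) = ?p1" using discrete_lift_eq[OF p Jp] g q by simp
  then have "f (\<pi> q0, \<pi> q1) (u, v) = differential MH (\<lambda>w. Lc (?p0, w, \<pi> q1)) \<one>\<^bsub>H\<^esub>
      (tangent_map (Q \<times>\<^sub>M Q) MH A (?p0, ?p1) (hlift ?p0 u, hlift ?p1 v))"
    unfolding reduced_force_def by (simp add: g(2) Let_def)
  also have "\<dots> = tangent_map (Q \<times>\<^sub>M Q) vs_manifold L (?p0, ?p1) (hlift ?p0 u, hlift ?p1 v) -
      tangent_map (B \<times>\<^sub>M B) vs_manifold Lr (\<pi> q0, \<pi> q1) (u, v)"
    using tangent_L_reduced[OF p Jp, of "hlift ?p0 u" "hlift ?p1 v"] hlift_spec(2)[OF p(1)] hlift_spec(2)[OF p(2)] g q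
    by simp
  also have "tangent_map (Q \<times>\<^sub>M Q) vs_manifold L (?p0, ?p1) (hlift ?p0 u, hlift ?p1 v) =
      tangent_map (Q \<times>\<^sub>M Q) vs_manifold L (q0, q1) (hlift q0 u, hlift q1 v)"
    using tangent_L_invariant[OF g(1) q] hlift_act[OF g(1)] q by simp
  finally show ?thesis
    by (simp add: tangent_L_split[OF q] tangent_Lr_split[OF q])
qed

section \<open>Equivalence of the equations of motion\<close>

lemma D1_L_linear: "q0 \<in> points Q \<Longrightarrow> q1 \<in> points Q \<Longrightarrow> linear (D1 Q L (q0, q1))"
  using has_tangent_linear[OF has_tangent_partial1[OF Q Q has_tangent_L]]
  by (simp add: D1_eq[OF Q Q has_tangent_L] linear_iff)

lemma D2_L_linear: "q0 \<in> points Q \<Longrightarrow> q1 \<in> points Q \<Longrightarrow> linear (D2 Q L (q0, q1))"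
  using has_tangent_linear[OF has_tangent_partial2[OF Q Q has_tangent_L]]
  by (simp add: D2_eq[OF Q Q has_tangent_L] linear_iff)

lemma D1_Lr_zero: "q0 \<in> points Q \<Longrightarrow> q1 \<in> points Q \<Longrightarrow> D1 B Lr (\<pi> q0, \<pi> q1) 0 = 0"
  using linear_0[OF has_tangent_linear[OF has_tangent_partial1[OF B B has_tangent_Lr]]]
  by (simp add: D1_eq[OF B B has_tangent_Lr])

lemma D2_Lr_zero: "q0 \<in> points Q \<Longrightarrow> q1 \<in> points Q \<Longrightarrow> D2 B Lr (\<pi> q0, \<pi> q1) 0 = 0"
  using linear_0[OF has_tangent_linear[OF has_tangent_partial2[OF B B has_tangent_Lr]]]
  by (simp add: D2_eq[OF B B has_tangent_Lr])

text \<open>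
  In vertical directions the equation is conservation of momentum, so only horizontal directions
  carry information.
\<close>

lemma euler_lagrange_iff_horizontal:
  assumes q: "p \<in> points Q" "q \<in> points Q" "r \<in> points Q" and J: "J (p, q) = \<nu>" "J (q, r) = \<nu>"
  shows "(\<forall>v. D2 Q L (p, q) v + D1 Q L (q, r) v = 0) \<longleftrightarrow>
    (\<forall>w. D2 Q L (p, q) (hlift q w) + D1 Q L (q, r) (hlift q w) = 0)" (is "?el \<longleftrightarrow> ?hor")
proof (intro iffI allI)
  fix v assume hor: ?hor
  obtain \<xi> w where v: "v = inf_gen H MH Q l \<xi> q + hlift q w"
    by (rule vertical_horizontal_split[OF q(2)])
  have "D2 Q L (p, q) (inf_gen H MH Q l \<xi> q) + D1 Q L (q, r) (inf_gen H MH Q l \<xi> q) = 0"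
    using J_eq_D2[OF q(1,2), of \<xi>] J_apply[of q r \<xi>] J by simp
  moreover have "D2 Q L (p, q) (hlift q w) + D1 Q L (q, r) (hlift q w) = 0" using hor by blast
  ultimately show "D2 Q L (p, q) v + D1 Q L (q, r) v = 0"
    unfolding v linear_add[OF D2_L_linear[OF q(1,2)]] linear_add[OF D1_L_linear[OF q(2,3)]] by simp
qed blast

text \<open>
  By \<open>force_eq\<close> the horizontal parts \<open>a k\<close> and \<open>b k\<close> of the two slots of \<open>dL\<close> are the reduced
  differentials plus the forces.  Hence both reduced statements say that \<open>b (k - 1) + a k\<close> vanishes at each
  interior vertex.
\<close>

theorem equations_of_motion_equivalent:
  fixes q :: "nat \<Rightarrow> 'q" and N :: nat
  assumes q_points: "\<And>k. k \<le> N \<Longrightarrow> q k \<in> points Q"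
    and q_momentum: "\<And>k. k < N \<Longrightarrow> J (q k, q (Suc k)) = \<nu>"
  defines "\<tau> \<equiv> \<lambda>k. \<pi> (q k)"
  defines "euler_lagrange \<equiv>
    (\<forall>k. 1 \<le> k \<and> k < N \<longrightarrow> (\<forall>v. D2 Q L (q (k - 1), q k) v + D1 Q L (q k, q (k + 1)) v = 0))"
  shows "(\<forall>dq. dq 0 = 0 \<and> dq N = 0 \<longrightarrow> curve_differential Q (action_sum L N) q dq = 0) \<longleftrightarrow>
      euler_lagrange" (is "?var \<longleftrightarrow> _")
    and "(\<forall>d\<tau>. d\<tau> 0 = 0 \<and> d\<tau> N = 0 \<longrightarrow> curve_differential B (action_sum Lr N) \<tau> d\<tau> =
        - (\<Sum>k<N. f (\<tau> k, \<tau> (k + 1)) (d\<tau> k, d\<tau> (k + 1)))) \<longleftrightarrow>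
      euler_lagrange" (is "?redvar \<longleftrightarrow> _")
    and "(\<forall>k. 1 \<le> k \<and> k < N \<longrightarrow>
        (\<forall>w. D1 B Lr (\<tau> k, \<tau> (k + 1)) w + D2 B Lr (\<tau> (k - 1), \<tau> k) w
             + f (\<tau> (k - 1), \<tau> k) (0, w) + f (\<tau> k, \<tau> (k + 1)) (w, 0) = 0)) \<longleftrightarrow>
      euler_lagrange" (is "?forced \<longleftrightarrow> _")
proof -
  have pts: "q k \<in> points Q" "q (Suc k) \<in> points Q" if "k < N" for k
    using q_points that by auto
  define a where "a k w = D1 Q L (q k, q (Suc k)) (hlift (q k) w)" for k w
  define b where "b k w = D2 Q L (q k, q (Suc k)) (hlift (q (Suc k)) w)" for k w
  have zero: "a k 0 = 0" "b k 0 = 0" if "k < N" for k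
    unfolding a_def b_def using pts[OF that] linear_0[OF D1_L_linear] linear_0[OF D2_L_linear]
    by (simp_all add: hlift_zero)
  have hor: "(\<forall>k. 1 \<le> k \<and> k < N \<longrightarrow> (\<forall>w. b (k - 1) w + a k w = 0)) \<longleftrightarrow> euler_lagrange"
  proof -
    have "(\<forall>w. b (k - 1) w + a k w = 0) \<longleftrightarrow>
        (\<forall>v. D2 Q L (q (k - 1), q k) v + D1 Q L (q k, q (k + 1)) v = 0)" if k: "1 \<le> k \<and> k < N" for k
    proof -
      obtain j where j: "k = Suc j" "j < N" using k by (cases k) auto
      show ?thesis
        using euler_lagrange_iff_horizontal[OF pts[OF j(2)] pts(2)[of k] q_momentum[OF j(2)]]
          q_momentum[of k] k
        unfolding a_def b_def j(1) by simp
    qed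
    then show ?thesis unfolding euler_lagrange_def by blast
  qed
  have force: "f (\<tau> k, \<tau> (Suc k)) (u, v) =
      (a k u - D1 B Lr (\<tau> k, \<tau> (Suc k)) u) + (b k v - D2 B Lr (\<tau> k, \<tau> (Suc k)) v)"
    if "k < N" for k u v
    unfolding a_def b_def \<tau>_def by (rule force_eq[OF pts[OF that] q_momentum[OF that]])
  have "?var \<longleftrightarrow> (\<forall>dq. dq 0 = 0 \<and> dq N = 0 \<longrightarrow>
      (\<Sum>k<N. D1 Q L (q k, q (Suc k)) (dq k) + D2 Q L (q k, q (Suc k)) (dq (Suc k))) = 0)"
    using curve_differential_action_sum[OF Q, of N L q] has_tangent_L pts by (metis (no_types, lifting))
  also have "\<dots> \<longleftrightarrow> (\<forall>k. 1 \<le> k \<and> k < N \<longrightarrow> (\<forall>v. D2 Q L (q (k - 1), q (Suc (k - 1))) v +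
      D1 Q L (q k, q (Suc k)) v = 0))"
    by (rule discrete_fundamental_lemma[where a = "\<lambda>k. D1 Q L (q k, q (Suc k))"
          and b = "\<lambda>k. D2 Q L (q k, q (Suc k))"])
      (use pts linear_0[OF D1_L_linear] linear_0[OF D2_L_linear] in auto)
  also have "\<dots> \<longleftrightarrow> euler_lagrange" unfolding euler_lagrange_def by auto
  finally show "?var \<longleftrightarrow> euler_lagrange" .
  have "curve_differential B (action_sum Lr N) \<tau> d\<tau> =
      - (\<Sum>k<N. f (\<tau> k, \<tau> (k + 1)) (d\<tau> k, d\<tau> (k + 1))) \<longleftrightarrow>
      (\<Sum>k<N. a k (d\<tau> k) + b k (d\<tau> (Suc k))) = 0" for d\<tau>
  proof -
    have "curve_differential B (action_sum Lr N) \<tau> d\<tau> = (\<Sum>k<N.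
        D1 B Lr (\<tau> k, \<tau> (Suc k)) (d\<tau> k) + D2 B Lr (\<tau> k, \<tau> (Suc k)) (d\<tau> (Suc k)))"
      by (rule curve_differential_action_sum[OF B])
        (unfold \<tau>_def, rule exI, rule has_tangent_Lr[OF pts])
    moreover have "(\<Sum>k<N. f (\<tau> k, \<tau> (k + 1)) (d\<tau> k, d\<tau> (k + 1))) =
        (\<Sum>k<N. a k (d\<tau> k) + b k (d\<tau> (Suc k))) - (\<Sum>k<N.
        D1 B Lr (\<tau> k, \<tau> (Suc k)) (d\<tau> k) + D2 B Lr (\<tau> k, \<tau> (Suc k)) (d\<tau> (Suc k)))"
      unfolding sum_subtractf[symmetric] by (rule sum.cong) (simp_all add: force)
    ultimately show ?thesis by linarith
  qed
  then have "?redvar \<longleftrightarrow>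
      (\<forall>d. d 0 = 0 \<and> d N = 0 \<longrightarrow> (\<Sum>k<N. a k (d k) + b k (d (Suc k))) = 0)" by simp
  also have "\<dots> \<longleftrightarrow> (\<forall>k. 1 \<le> k \<and> k < N \<longrightarrow> (\<forall>w. b (k - 1) w + a k w = 0))"
    by (rule discrete_fundamental_lemma) (use zero in auto)
  finally show "?redvar \<longleftrightarrow> euler_lagrange" unfolding hor .
  have "D1 B Lr (\<tau> k, \<tau> (k + 1)) w + D2 B Lr (\<tau> (k - 1), \<tau> k) w
      + f (\<tau> (k - 1), \<tau> k) (0, w) + f (\<tau> k, \<tau> (k + 1)) (w, 0) = b (k - 1) w + a k w"
    if k: "1 \<le> k \<and> k < N" for k w
  proof -
    obtain j where j: "k = Suc j" "j < N" using k by (cases k) auto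
    have "D1 B Lr (\<tau> j, \<tau> (Suc j)) 0 = 0" "D2 B Lr (\<tau> k, \<tau> (Suc k)) 0 = 0"
      unfolding \<tau>_def using D1_Lr_zero D2_Lr_zero pts[OF j(2)] pts[of k] k by auto
    then show ?thesis
      using force[OF j(2), of 0 w] force[of k w 0] zero[of k] zero[OF j(2)] k j by simp
  qed
  then show "?forced \<longleftrightarrow> euler_lagrange" unfolding hor[symmetric] by simp
qed

end

text \<open>
  It remains to verify that \<open>G\<^sub>\<mu>\<close> satisfies the hypotheses of the reduction: its operations are those of \<open>G\<close>,
  its action is differentiable because its inclusion into \<open>G\<close> is, and \<open>\<nu>\<close> is invariant under \<open>Ad\<close> because
  the inclusion intertwines the two adjoint actions and \<open>G\<^sub>\<mu>\<close> fixes \<open>\<mu>\<close>.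
\<close>

theorem theorem3p15:
  fixes Q :: "('q, 'e::real_normed_vector) manifold"
    and G :: "'g monoid"
    and MG :: "('g, 'l::real_normed_vector) manifold"
    and MG\<^sub>\<mu> :: "('g, 'h::real_normed_vector) manifold"
    and B :: "('q set, 'b::real_normed_vector) manifold"
    and l :: "'g \<Rightarrow> 'q \<Rightarrow> 'q"
    and L :: "'q \<times> 'q \<Rightarrow> real"
    and \<mu> :: "'l \<Rightarrow> real"
    and \<AA> :: "'q \<Rightarrow> 'e \<Rightarrow> 'h"
    and q :: "nat \<Rightarrow> 'q" and N :: nat
  defines "G\<^sub>\<mu> \<equiv> isotropy_group G MG \<mu>"
  defines "\<nu> \<equiv> restrict_dual G MG MG\<^sub>\<mu> \<mu>"
  defines "\<pi> \<equiv> orbit G\<^sub>\<mu> l"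
  defines "J \<equiv> momentum_map G\<^sub>\<mu> MG\<^sub>\<mu> Q l L"
  defines "A \<equiv> affine_connection G\<^sub>\<mu> l J \<nu>"
  defines "hdisc \<equiv> discrete_lift Q \<pi> J \<nu>"
  defines "hlift \<equiv> horizontal_lift Q B \<pi> \<AA>"
  defines "Lc \<equiv> check_lagrangian l hdisc L"
  defines "Lr \<equiv> reduced_lagrangian G\<^sub>\<mu> Q \<pi> Lc"
  defines "f \<equiv> reduced_force G\<^sub>\<mu> MG\<^sub>\<mu> Q \<pi> hdisc hlift A Lc"
  defines "\<tau> \<equiv> \<lambda>k. \<pi> (q k)"
  assumes Q: "smooth_manifold Q"
    and L_smooth: "smooth_map (Q \<times>\<^sub>M Q) vs_manifold L"
    and G: "lie_group G MG"
    and action: "smooth_action G MG Q l" "free_action G Q l" "proper_action MG Q l"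
    and L_invariant:
      "\<And>g q0 q1. g \<in> carrier G \<Longrightarrow> q0 \<in> points Q \<Longrightarrow> q1 \<in> points Q \<Longrightarrow> L (l g q0, l g q1) = L (q0, q1)"
    and \<mu>: "linear \<mu>"
    and G\<^sub>\<mu>: "lie_group G\<^sub>\<mu> MG\<^sub>\<mu>" "embedded_submanifold MG\<^sub>\<mu> MG"
    and princ_bundle: "quotient_principal_bundle G\<^sub>\<mu> MG\<^sub>\<mu> Q l B"
    and good: "good_symmetries G\<^sub>\<mu> MG\<^sub>\<mu> Q l L \<nu>"
    and A_ex1: "\<And>q0 q1. q0 \<in> points Q \<Longrightarrow> q1 \<in> points Q \<Longrightarrow>
                  \<exists>!g. g \<in> carrier G\<^sub>\<mu> \<and> J (q0, l (inv\<^bsub>G\<^sub>\<mu>\<^esub> g) q1) = \<nu>"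
    and A_smooth: "smooth_map (Q \<times>\<^sub>M Q) MG\<^sub>\<mu> A"
    and connection: "principal_connection G\<^sub>\<mu> MG\<^sub>\<mu> Q l \<AA>"
    and q_points: "\<And>k. k \<le> N \<Longrightarrow> q k \<in> points Q"
    and q_momentum: "\<And>k. k < N \<Longrightarrow> J (q k, q (Suc k)) = \<nu>"
  defines "variational \<equiv>
      (\<forall>dq. dq 0 = 0 \<and> dq N = 0 \<longrightarrow> curve_differential Q (action_sum L N) q dq = 0)"
    and "euler_lagrange \<equiv>
      (\<forall>k. 1 \<le> k \<and> k < N \<longrightarrow>
        (\<forall>v. D2 Q L (q (k - 1), q k) v + D1 Q L (q k, q (k + 1)) v = 0))"
    and "reduced_variational \<equiv>
      (\<forall>d\<tau>. d\<tau> 0 = 0 \<and> d\<tau> N = 0 \<longrightarrow>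
        curve_differential B (action_sum Lr N) \<tau> d\<tau>
          = - (\<Sum>k<N. f (\<tau> k, \<tau> (k + 1)) (d\<tau> k, d\<tau> (k + 1))))"
    and "forced_euler_lagrange \<equiv>
      (\<forall>k. 1 \<le> k \<and> k < N \<longrightarrow>
        (\<forall>w. D1 B Lr (\<tau> k, \<tau> (k + 1)) w + D2 B Lr (\<tau> (k - 1), \<tau> k) w
             + f (\<tau> (k - 1), \<tau> k) (0, w) + f (\<tau> k, \<tau> (k + 1)) (w, 0) = 0))"
  shows "(variational \<longleftrightarrow> euler_lagrange) \<and>
         (euler_lagrange \<longleftrightarrow> reduced_variational) \<and>
         (reduced_variational \<longleftrightarrow> forced_euler_lagrange)"
proof -
  have G_group: "group G" and MG: "charted MG" and carrier_G: "carrier G = points MG"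
    using G charted_smooth_manifold unfolding lie_group_def by blast+
  interpret G: group G by (rule G_group)
  have H_group: "group G\<^sub>\<mu>" and MH: "charted MG\<^sub>\<mu>" and carrier_H: "carrier G\<^sub>\<mu> = points MG\<^sub>\<mu>"
    using G\<^sub>\<mu>(1) charted_smooth_manifold unfolding lie_group_def by blast+
  have sub: "carrier G\<^sub>\<mu> \<subseteq> carrier G"
    and mult: "g \<otimes>\<^bsub>G\<^sub>\<mu>\<^esub> h = g \<otimes>\<^bsub>G\<^esub> h" and one: "\<one>\<^bsub>G\<^sub>\<mu>\<^esub> = \<one>\<^bsub>G\<^esub>" for g h
    unfolding G\<^sub>\<mu>_def isotropy_group_def by auto
  interpret H: group G\<^sub>\<mu> by (rule H_group)
  have inv: "inv\<^bsub>G\<^sub>\<mu>\<^esub> g = inv\<^bsub>G\<^esub> g" if "g \<in> carrier G\<^sub>\<mu>" for g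
    by (rule G.inv_equality[symmetric])
      (use H.l_inv[OF that] H.inv_closed[OF that] that sub in \<open>auto simp: mult one\<close>)
  have incl: "has_tangent MG\<^sub>\<mu> MG (\<lambda>g. g) g (tangent_map MG\<^sub>\<mu> MG (\<lambda>g. g) g)"
    if "g \<in> carrier G\<^sub>\<mu>" for g
    using G\<^sub>\<mu>(2) that unfolding embedded_submanifold_def carrier_H
    by (intro has_tangent_smooth MH MG) auto
  have act: "group_action G (points Q) l"
    and act_smooth: "smooth_map (MG \<times>\<^sub>M Q) Q (\<lambda>(g, q). l g q)"
    using action(1) unfolding smooth_action_def by auto
  note Qc = charted_smooth_manifold[OF Q]
  have reduction: "symmetry_reduction Q G\<^sub>\<mu> MG\<^sub>\<mu> B l L \<nu> \<AA>"
  proof (rule symmetry_reduction.intro)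
    show "group_action G\<^sub>\<mu> (points Q) l"
      using act H_group sub unfolding group_action_def group_hom_def group_hom_axioms_def hom_def
      by (auto simp: mult)
  next
    fix g x assume g: "g \<in> carrier G\<^sub>\<mu>" and x: "x \<in> points Q"
    note HQ = charted_prod[OF MH Qc]
    have gx: "g \<in> points MG\<^sub>\<mu>" "g \<in> points MG" using g sub carrier_G carrier_H by auto
    have "has_tangent (MG \<times>\<^sub>M Q) Q (\<lambda>(g, q). l g q) (g, x)
        (tangent_map (MG \<times>\<^sub>M Q) Q (\<lambda>(g, q). l g q) (g, x))"
      by (rule has_tangent_smooth[OF charted_prod[OF MG Qc] Qc act_smooth]) (use gx x in simp)
    moreover have "has_tangent (MG\<^sub>\<mu> \<times>\<^sub>M Q) MG (\<lambda>z. fst z) (g, x)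
        (\<lambda>v. tangent_map MG\<^sub>\<mu> MG (\<lambda>g. g) g (fst v))"
      by (rule has_tangent_compose[OF HQ MH has_tangent_fst[OF MH Qc gx(1) x]]) (use incl[OF g] in simp)
    ultimately have "has_tangent (MG\<^sub>\<mu> \<times>\<^sub>M Q) Q (\<lambda>z. (\<lambda>(g, q). l g q) (fst z, snd z)) (g, x)
        (\<lambda>v. tangent_map (MG \<times>\<^sub>M Q) Q (\<lambda>(g, q). l g q) (g, x)
          (tangent_map MG\<^sub>\<mu> MG (\<lambda>g. g) g (fst v), snd v))"
      by (intro has_tangent_compose2[OF HQ MG Qc _ has_tangent_snd[OF MH Qc gx(1) x]]) simp_all
    then show "\<exists>D. has_tangent (MG\<^sub>\<mu> \<times>\<^sub>M Q) Q (\<lambda>(g, q). l g q) (g, x) D"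
      by auto
  next
    fix g \<xi> assume g: "g \<in> carrier G\<^sub>\<mu>"
    let ?T = "tangent_map MG\<^sub>\<mu> MG (\<lambda>g. g) \<one>\<^bsub>G\<^esub>"
    have gG: "g \<in> carrier G" using g sub by auto
    have oneH: "\<one>\<^bsub>G\<^esub> \<in> carrier G\<^sub>\<mu>" using H.one_closed one by simp
    have "has_tangent MG\<^sub>\<mu> MG (\<lambda>h. g \<otimes>\<^bsub>G\<^sub>\<mu>\<^esub> h \<otimes>\<^bsub>G\<^sub>\<mu>\<^esub> inv\<^bsub>G\<^sub>\<mu>\<^esub> g) \<one>\<^bsub>G\<^sub>\<mu>\<^esub> (\<lambda>\<xi>. ?T (Ad G\<^sub>\<mu> MG\<^sub>\<mu> g \<xi>))"
      by (rule has_tangent_compose[OF MH MH lie_group_has_tangent_Ad[OF G\<^sub>\<mu>(1) g]])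
        (use incl[OF oneH] g in \<open>simp add: one[symmetric]\<close>)
    moreover have "has_tangent MG\<^sub>\<mu> MG (\<lambda>h. g \<otimes>\<^bsub>G\<^sub>\<mu>\<^esub> h \<otimes>\<^bsub>G\<^sub>\<mu>\<^esub> inv\<^bsub>G\<^sub>\<mu>\<^esub> g) \<one>\<^bsub>G\<^sub>\<mu>\<^esub> (\<lambda>\<xi>. Ad G MG g (?T \<xi>))"
      unfolding mult one inv[OF g]
      by (rule has_tangent_compose[OF MH MG incl[OF oneH] lie_group_has_tangent_Ad[OF G gG]])
    \<comment> \<open>Conjugation in \<open>G\<^sub>\<mu>\<close> followed by the inclusion into \<open>G\<close> is conjugation in \<open>G\<close>.\<close>
    ultimately have "(\<lambda>\<xi>. ?T (Ad G\<^sub>\<mu> MG\<^sub>\<mu> g \<xi>)) = (\<lambda>\<xi>. Ad G MG g (?T \<xi>))"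
      by (rule has_tangent_unique)
    then have T: "?T (Ad G\<^sub>\<mu> MG\<^sub>\<mu> g \<xi>) = Ad G MG g (?T \<xi>)" by (rule fun_cong)
    have "inv\<^bsub>G\<^esub> g \<in> carrier G\<^sub>\<mu>" using H.inv_closed[OF g] inv[OF g] by simp
    \<comment> \<open>The isotropy condition speaks of \<open>g\<^sup>-\<^sup>1\<close>; it is applied to the inverse, which lies in \<open>G\<^sub>\<mu>\<close> as well.\<close>
    then have "coAd G MG g \<mu> = \<mu>" unfolding G\<^sub>\<mu>_def isotropy_group_def using gG by simp
    then have "\<mu> (Ad G MG g \<eta>) = \<mu> \<eta>" for \<eta> unfolding coAd_def by metis
    then show "\<nu> (Ad G\<^sub>\<mu> MG\<^sub>\<mu> g \<xi>) = \<nu> \<xi>" unfolding \<nu>_def restrict_dual_def T by simp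
  qed (use Qc L_smooth G\<^sub>\<mu>(1) L_invariant sub princ_bundle A_ex1[unfolded J_def]
        A_smooth[unfolded A_def J_def] connection in auto)
  interpret R: symmetry_reduction Q G\<^sub>\<mu> MG\<^sub>\<mu> B l L \<nu> \<AA> J A
    by (rule reduction J_def A_def)+
  show ?thesis
    using R.equations_of_motion_equivalent[where q = q and N = N, OF q_points q_momentum]
    unfolding variational_def euler_lagrange_def reduced_variational_def forced_euler_lagrange_def
      f_def Lr_def Lc_def hlift_def hdisc_def \<tau>_def \<pi>_def by simp
qed

end
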